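(* Let $X$ be a compact convex set and let $u\in A_c(X)$. Then the following assertions are equivalent. (1) $u$ is a multiplier for $A_c(X)$. (2) If $\mu,\nu\in M_1(\overline{\operatorname{ext}X})$ have the same barycenter and $B\subset\mathbb R$ is a Borel set, then $\mu(u^{-1}(B))=\nu(u^{-1}(B))$ and, moreover, if this number is strictly positive, then the probabilities $$\frac{\mu|_{u^{-1}(B)}}{\mu(u^{-1}(B))}\quad\text{and}\quad\frac{\nu|_{u^{-1}(B)}}{\nu(u^{-1}(B))}$$ have the same barycenter.
   Context: A compact convex set is a compact convex subset of a (Hausdorff) locally convex real topological vector space; $\operatorname{ext}X$ is the set of its extreme points. $A_c(X)$ is the space of continuous affine real functions on $X$. A function $u\in A_c(X)$ is a multiplier for $A_c(X)$ if for any $a\in A_c(X)$ there is $b\in A_c(X)$ with $b=u\cdot a$ on $\operatorname{ext}X$. $M_1(\overline{\operatorname{ext}X})$ is the set of Radon probability measures on $X$ carried by the closed set $\overline{\operatorname{ext}X}$. The barycenter of a Radon probability measure $\mu$ on $X$ is the unique $x\in X$ with $a(x)=\int_X a\,d\mu$ for every $a\in A_c(X)$. *)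

theory Defs
  imports "HOL-Probability.Probability"
begin

text \<open>Hausdorff locally convex real topological vector spaces. The last condition is the
  definition of \<^const>\<open>convex\<close> written out: that constant is not available inside a class
  specification.\<close>

class locally_convex_space = real_vector + topological_ab_group_add + t2_space +
  assumes tendsto_scaleR_Pair:
      "((\<lambda>p. fst p *\<^sub>R snd p) \<longlongrightarrow> c *\<^sub>R x) (nhds c \<times>\<^sub>F nhds x)"
    and open_convex_nhd_0:
      "open U \<Longrightarrow> 0 \<in> U \<Longrightarrow> \<exists>V. open V \<and> 0 \<in> V \<and> V \<subseteq> U \<and>
         (\<forall>x\<in>V. \<forall>y\<in>V. \<forall>s\<ge>0. \<forall>t\<ge>0. s + t = 1 \<longrightarrow> s *\<^sub>R x + t *\<^sub>R y \<in> V)"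

definition ext :: "'a::real_vector set \<Rightarrow> 'a set" where
  "ext X = {x. x extreme_point_of X}"

text \<open>Functions on \<open>X\<close> are represented by functions on the ambient space; their values
  outside \<open>X\<close> are irrelevant throughout.\<close>

definition A_c :: "'a::{real_vector, topological_space} set \<Rightarrow> ('a \<Rightarrow> real) set" where
  "A_c X = {a. continuous_on X a \<and>
     (\<forall>x\<in>X. \<forall>y\<in>X. \<forall>t\<in>{0..1}. a ((1 - t) *\<^sub>R x + t *\<^sub>R y) = (1 - t) * a x + t * a y)}"

definition multiplier :: "'a::{real_vector, topological_space} set \<Rightarrow> ('a \<Rightarrow> real) \<Rightarrow> bool" where
  "multiplier X u \<longleftrightarrow> u \<in> A_c X \<and> (\<forall>a\<in>A_c X. \<exists>b\<in>A_c X. \<forall>x\<in>ext X. b x = u x * a x)"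

definition radon_prob :: "'a::topological_space set \<Rightarrow> 'a measure \<Rightarrow> bool" where
  "radon_prob X \<mu> \<longleftrightarrow> prob_space \<mu> \<and> space \<mu> = X \<and> sets \<mu> = sets (restrict_space borel X) \<and>
     (\<forall>A\<in>sets \<mu>. emeasure \<mu> A = (SUP K\<in>{K. compact K \<and> K \<subseteq> A}. emeasure \<mu> K))"

text \<open>Radon probability measures on \<open>X\<close> that are carried by the closed set \<open>F \<subseteq> X\<close>.\<close>

definition M_1 :: "'a::topological_space set \<Rightarrow> 'a set \<Rightarrow> 'a measure set" where
  "M_1 X F = {\<mu>. radon_prob X \<mu> \<and> emeasure \<mu> (X - F) = 0}"

definition represents ::
  "'a::{real_vector, topological_space} set \<Rightarrow> 'a measure \<Rightarrow> 'a \<Rightarrow> bool" where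
  "represents X \<mu> x \<longleftrightarrow> x \<in> X \<and> (\<forall>a\<in>A_c X. a x = (\<integral>y. a y \<partial>\<mu>))"

text \<open>The barycenter is the unique representing point. It is given as a relation, so that
  ``having the same barycenter'' includes that the barycenters exist.\<close>

definition has_barycenter ::
  "'a::{real_vector, topological_space} set \<Rightarrow> 'a measure \<Rightarrow> 'a \<Rightarrow> bool" where
  "has_barycenter X \<mu> x \<longleftrightarrow> (\<forall>y. represents X \<mu> y \<longleftrightarrow> y = x)"

definition same_barycenter ::
  "'a::{real_vector, topological_space} set \<Rightarrow> 'a measure \<Rightarrow> 'a measure \<Rightarrow> bool" where
  "same_barycenter X \<mu> \<nu> \<longleftrightarrow> (\<exists>x. has_barycenter X \<mu> x \<and> has_barycenter X \<nu> x)"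

end

theory Submission
  imports Defs "HOL-Library.Function_Algebras"
begin

text \<open>If \<open>u\<close> is a multiplier and \<open>\<mu>\<close>, \<open>\<nu>\<close> represent the same point, then iterating the
  multiplication gives \<open>\<integral> u\<^sup>n a \<partial>\<mu> = \<integral> u\<^sup>n a \<partial>\<nu>\<close> for all \<open>n\<close>, because both measures live on
  the closure of \<open>ext X\<close>. By Weierstrass approximation the functions \<open>1\<^bsub>B\<^esub>(u) a\<close> then have equal
  integrals for every Borel set \<open>B\<close>, which is (2).

  Conversely, (2) yields \<open>\<integral> u a \<partial>\<mu> = \<integral> u a \<partial>\<nu>\<close>. By the theorems of Hahn-Banach and Riesz and
  Bauer's minimum principle, the infimum at \<open>x\<close> of the \<open>h \<in> A\<^sub>c(X)\<close> with \<open>h \<ge> u a\<close> on \<open>ext X\<close>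
  is attained as \<open>\<integral> u a \<partial>\<mu>\<close> for a measure \<open>\<mu>\<close> representing \<open>x\<close>, and likewise for the
  corresponding supremum. Hence the two envelopes coincide. The first is concave and upper
  semicontinuous, the second convex and lower semicontinuous, so that their common value is the
  required function \<open>b\<close>.\<close>

section \<open>Hahn-Banach theorem\<close>

text \<open>The set \<open>ext X\<close> need be neither closed nor Borel. Continuity is the bridge:
  an identity of continuous functions on \<open>ext X\<close> persists on the closure, which carries
  the measures. The envelopes are formed with inequalities on \<open>ext X\<close> alone, so 0 is
  among the majorants of any continuous function that is nonpositive there; the functional given by
  Hahn-Banach is then nonpositive on it, which forces its measure onto the closure of
  \<open>ext X\<close>. The minimum principle keeps such envelopes finite. Both directions compare
  the images under \<open>u\<close> of the measures with density \<open>a\<close>. These are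
  positive only for \<open>a \<ge> 0\<close>, and adding a constant to \<open>a\<close> reduces the
  general case to this one. Equal moments identify the images; conversely, (2) makes the images
  agree on every Borel set, and integrating the identity function against them gives the integral of
  \<open>u \<cdot> a\<close>. Having the same barycenter includes its existence, so barycenters must
  be constructed for conditioned measures; this is done by compactness and a least squares
  problem.\<close>

instantiation "fun" :: (type, real_vector) real_vector
begin

definition scaleR_fun :: "real \<Rightarrow> ('a \<Rightarrow> 'b) \<Rightarrow> 'a \<Rightarrow> 'b"
  where "scaleR_fun c f = (\<lambda>x. c *\<^sub>R f x)"

instance
  by standard (auto simp: scaleR_fun_def fun_eq_iff algebra_simps)

end

text \<open>Relative to a subspace \<open>V\<close>, because the vectors will be real functions and
  \<open>V\<close> those continuous on \<open>X\<close>; the envelope to which this is applied is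
  controlled only for these.\<close>

definition sublinear_on :: "'v::real_vector set \<Rightarrow> ('v \<Rightarrow> real) \<Rightarrow> bool" where
  "sublinear_on V p \<longleftrightarrow> (\<forall>x\<in>V. \<forall>y\<in>V. p (x + y) \<le> p x + p y) \<and>
     (\<forall>x\<in>V. \<forall>c\<ge>0. p (c *\<^sub>R x) = c * p x)"

lemma sublinear_onD:
  assumes "sublinear_on V p" "x \<in> V"
  shows "y \<in> V \<Longrightarrow> p (x + y) \<le> p x + p y" and "c \<ge> 0 \<Longrightarrow> p (c *\<^sub>R x) = c * p x"
  using assms by (auto simp: sublinear_on_def)

lemma sublinear_on_0:
  assumes "subspace V" "sublinear_on V p"
  shows "p 0 = 0"
  using sublinear_onD(2)[OF assms(2) subspace_0[OF assms(1)], of 0] by simp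

lemma sublinear_on_minus:
  assumes "subspace V" "sublinear_on V p" "x \<in> V"
  shows "- p (- x) \<le> p x"
  using sublinear_onD(1)[OF assms(2,3), of "- x"] assms sublinear_on_0[OF assms(1,2)]
  by (simp add: subspace_neg)

text \<open>Applied to \<open>c *\<^sub>R x\<close> with the factor \<open>inverse c\<close>, the
  inequality \<open>scale\<close> yields its own converse.\<close>

lemma sublinear_onI:
  assumes V: "subspace V"
    and add: "\<And>x y. x \<in> V \<Longrightarrow> y \<in> V \<Longrightarrow> p (x + y) \<le> p x + p y"
    and 0: "p 0 = 0"
    and scale: "\<And>x c. x \<in> V \<Longrightarrow> c > 0 \<Longrightarrow> p (c *\<^sub>R x) \<le> c * p x"
  shows "sublinear_on V p"
proof -
  have "p (c *\<^sub>R x) = c * p x" if x: "x \<in> V" and c: "c \<ge> 0" for x c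
  proof (cases "c = 0")
    case False
    then have "p (inverse c *\<^sub>R c *\<^sub>R x) \<le> inverse c * p (c *\<^sub>R x)"
      using scale[of "c *\<^sub>R x" "inverse c"] x c V by (simp add: subspace_scale)
    then have "c * p x \<le> p (c *\<^sub>R x)"
      using False c by (simp add: field_simps)
    then show ?thesis using scale[of x c] x c False by force
  qed (use 0 in auto)
  then show ?thesis using add by (auto simp: sublinear_on_def)
qed

text \<open>A linear \<open>f\<close> below \<open>q\<close> satisfies
  \<open>f x0 \<ge> p x0\<close>, so \<open>q\<close> prescribes the value at \<open>x0\<close>
  before any linear functional is known. The infimum of
  \<open>p (x + t *\<^sub>R x0) - t * p x0\<close> over \<open>t \<ge> 0\<close> is the largest
  sublinear minorant of \<open>p\<close> with \<open>q (- x0) \<le> - p x0\<close>.\<close>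

lemma sublinear_on_lower:
  assumes V: "subspace V" and p: "sublinear_on V p" and x0: "x0 \<in> V"
  obtains q where "sublinear_on V q" "\<And>x. x \<in> V \<Longrightarrow> q x \<le> p x" "q (- x0) \<le> - p x0"
proof -
  define g where "g x t = p (x + t *\<^sub>R x0) - t * p x0" for x and t :: real
  define q where "q x = (INF t\<in>{0..}. g x t)" for x
  have bdd: "bdd_below (g x ` {0..})" if x: "x \<in> V" for x
  proof (rule bdd_belowI2)
    fix t :: real assume t: "t \<in> {0..}"
    have "t * p x0 = p ((x + t *\<^sub>R x0) + (- x))"
      using sublinear_onD(2)[OF p x0, of t] t by simp
    also have "\<dots> \<le> p (x + t *\<^sub>R x0) + p (- x)"
      using V x x0 by (intro sublinear_onD(1)[OF p] subspace_add subspace_scale subspace_neg)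
    finally show "- p (- x) \<le> g x t" by (simp add: g_def)
  qed
  have le: "q x \<le> g x t" if "x \<in> V" "t \<ge> 0" for x t
    unfolding q_def using that by (intro cINF_lower bdd) auto
  have ge: "a \<le> q x" if "\<And>t. t \<ge> 0 \<Longrightarrow> a \<le> g x t" for a x
    unfolding q_def using that by (intro cINF_greatest) auto
  have "sublinear_on V q"
  proof (rule sublinear_onI[OF V])
    fix x y assume xy: "x \<in> V" "y \<in> V"
    have *: "q (x + y) \<le> g x s + g y t" if st: "s \<ge> 0" "t \<ge> 0" for s t
    proof -
      have "q (x + y) \<le> g (x + y) (s + t)"
        using le xy V st by (simp add: subspace_add)
      also have "\<dots> = p ((x + s *\<^sub>R x0) + (y + t *\<^sub>R x0)) - (s + t) * p x0"
        by (simp add: g_def algebra_simps)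
      also have "\<dots> \<le> g x s + g y t"
        using sublinear_onD(1)[OF p, of "x + s *\<^sub>R x0" "y + t *\<^sub>R x0"] V xy x0
        by (simp add: g_def algebra_simps subspace_add subspace_scale)
      finally show ?thesis .
    qed
    \<comment> \<open>From all pairs \<open>s\<close>, \<open>t\<close> to the infima, one variable
      at a time.\<close>
    have "q (x + y) - g y t \<le> q x" if "t \<ge> 0" for t
      using *[OF _ that] by (intro ge) (simp add: algebra_simps)
    then have "q (x + y) - q x \<le> q y"
      by (intro ge) (simp add: algebra_simps)
    then show "q (x + y) \<le> q x + q y" by simp
  next
    have "g 0 t = 0" if "t \<ge> 0" for t
      using sublinear_onD(2)[OF p x0 that] by (simp add: g_def)
    then show "q 0 = 0" by (simp add: q_def)
  next
    fix x and c :: real assume x: "x \<in> V" and c: "c > 0"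
    have "q (c *\<^sub>R x) / c \<le> g x t" if t: "t \<ge> 0" for t
    proof -
      \<comment> \<open>The parameter is scaled along with \<open>x\<close>, so that
        \<open>c\<close> factors out.\<close>
      have "q (c *\<^sub>R x) \<le> g (c *\<^sub>R x) (c * t)"
        using le x c t V by (simp add: subspace_scale)
      also have "\<dots> = p (c *\<^sub>R (x + t *\<^sub>R x0)) - c * t * p x0"
        by (simp add: g_def algebra_simps)
      also have "\<dots> = c * g x t"
        using sublinear_onD(2)[OF p, of "x + t *\<^sub>R x0" c] x x0 V c
        by (simp add: g_def algebra_simps subspace_add subspace_scale)
      finally show ?thesis using c by (simp add: field_simps)
    qed
    then have "q (c *\<^sub>R x) / c \<le> q x" by (rule ge)
    then show "q (c *\<^sub>R x) \<le> c * q x" using c by (simp add: field_simps)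
  qed
  moreover have "q x \<le> p x" if "x \<in> V" for x
    using le[OF that, of 0] by (simp add: g_def)
  moreover have "q (- x0) \<le> - p x0"
    using le[of "- x0" 1] V x0 sublinear_on_0[OF V p] by (simp add: g_def subspace_neg)
  ultimately show thesis using that by blast
qed

text \<open>A minimal sublinear functional is linear, since the previous lemma makes it odd.\<close>

lemma minimal_sublinear_linear:
  assumes V: "subspace V" and p: "sublinear_on V p"
  obtains f where "\<And>x y. x \<in> V \<Longrightarrow> y \<in> V \<Longrightarrow> f (x + y) = f x + f y"
    "\<And>x c. x \<in> V \<Longrightarrow> f (c *\<^sub>R x) = c * f x" "\<And>x. x \<in> V \<Longrightarrow> f x \<le> p x"
proof -
  \<comment> \<open>\<open>P\<close> compares functions on the whole type, so values off
    \<open>V\<close> are frozen at 0; left free, they could be lowered forever. \<open>P\<close>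
    places smaller functions higher, hence Zorn's lemma gives a minimal one.\<close>
  define A where "A = {q. sublinear_on V q \<and> (\<forall>x\<in>V. q x \<le> p x) \<and> (\<forall>x. x \<notin> V \<longrightarrow> q x = 0)}"
  define P where "P q r \<longleftrightarrow> (\<forall>x. r x \<le> q x)" for q r :: "'a \<Rightarrow> real"
  have Vadd: "x + y \<in> V" if "x \<in> V" "y \<in> V" for x y using V that by (simp add: subspace_add)
  have Vsc: "c *\<^sub>R x \<in> V" if "x \<in> V" for x c using V that by (simp add: subspace_scale)
  have restrict: "(\<lambda>x. if x \<in> V then q x else 0) \<in> A"
    if "sublinear_on V q" "\<forall>x\<in>V. q x \<le> p x" for q
    using that Vadd Vsc by (auto simp: A_def sublinear_on_def)
  have "\<exists>m\<in>A. \<forall>a\<in>A. P m a \<longrightarrow> a = m"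
  proof (rule predicate_Zorn)
    show "partial_order_on A (relation_of P A)"
      by (rule partial_order_on_relation_ofI)
        (auto simp: P_def fun_eq_iff intro: order.trans order.antisym)
    fix C assume "C \<in> Chains (relation_of P A)"
    then have CA: "C \<subseteq> A" and chain: "\<And>q r. q \<in> C \<Longrightarrow> r \<in> C \<Longrightarrow> P q r \<or> P r q"
      by (auto simp: Chains_def relation_of_def)
    show "\<exists>u\<in>A. \<forall>a\<in>C. P a u"
    proof (cases "C = {}")
      case True
      then show ?thesis using restrict[OF p] by auto
    next
      case False
      define u where "u x = (INF q\<in>C. q x)" for x
      \<comment> \<open>Since \<open>q (- x) \<le> p (- x)\<close>, the bound can be chosen
        independently of \<open>q\<close>; it keeps the infimum of the chain finite.\<close>
      have low: "- p (- x) \<le> q x" if "x \<in> V" "q \<in> C" for x q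
        using sublinear_on_minus[OF V _ that(1), of q] that CA subspace_neg[OF V, of x]
        by (force simp: A_def)
      have bdd: "bdd_below ((\<lambda>q. q x) ` C)" for x
        using low CA by (cases "x \<in> V") (force simp: A_def bdd_below_def)+
      have le: "u x \<le> q x" if "q \<in> C" for q x
        unfolding u_def using that by (intro cINF_lower bdd) auto
      have ge: "a \<le> u x" if "\<And>q. q \<in> C \<Longrightarrow> a \<le> q x" for a x
        unfolding u_def using that False by (intro cINF_greatest) auto
      have sub: "sublinear_on V q" if "q \<in> C" for q using that CA by (auto simp: A_def)
      have "sublinear_on V u"
      proof (rule sublinear_onI[OF V])
        fix x y assume xy: "x \<in> V" "y \<in> V"
        have *: "u (x + y) \<le> q x + r y" if qr: "q \<in> C" "r \<in> C" for q r
        proof -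
          \<comment> \<open>An infimum of sublinear functions need not be subadditive; in a chain
            one \<open>s\<close> lies below both \<open>q\<close> and \<open>r\<close>.\<close>
          obtain s where s: "s \<in> C" "\<And>x. s x \<le> q x" "\<And>x. s x \<le> r x"
            using chain[OF qr] qr by (auto simp: P_def)
          have "u (x + y) \<le> s x + s y"
            using le[OF s(1)] sublinear_onD(1)[OF sub[OF s(1)] xy] order.trans by blast
          then show ?thesis using s(2)[of x] s(3)[of y] by linarith
        qed
        have "u (x + y) - r y \<le> u x" if "r \<in> C" for r
          using *[OF _ that] by (intro ge) (simp add: algebra_simps)
        then have "u (x + y) - u x \<le> u y"
          by (intro ge) (simp add: algebra_simps)
        then show "u (x + y) \<le> u x + u y" by simp
      next
        have "(\<lambda>q. q 0) ` C = (\<lambda>_. 0) ` C"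
          by (rule image_cong[OF refl]) (rule sublinear_on_0[OF V sub])
        then show "u 0 = 0" using False by (simp add: u_def image_constant_conv)
      next
        fix x and c :: real assume x: "x \<in> V" and c: "c > 0"
        have "u (c *\<^sub>R x) / c \<le> u x"
        proof (rule ge)
          fix q assume q: "q \<in> C"
          show "u (c *\<^sub>R x) / c \<le> q x"
            using le[OF q, of "c *\<^sub>R x"] sublinear_onD(2)[OF sub[OF q] x, of c] c
            by (simp add: field_simps)
        qed
        then show "u (c *\<^sub>R x) \<le> c * u x" using c by (simp add: field_simps)
      qed
      moreover have "u x \<le> p x" if x: "x \<in> V" for x
      proof -
        obtain q where q: "q \<in> C" using False by blast
        then have "q x \<le> p x" using CA x by (auto simp: A_def)
        then show ?thesis using le[OF q, of x] by linarith
      qed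
      moreover have "u x = 0" if "x \<notin> V" for x
      proof -
        have "(\<lambda>q. q x) ` C = (\<lambda>_. 0) ` C"
          by (rule image_cong[OF refl]) (use that CA in \<open>auto simp: A_def\<close>)
        then show ?thesis using False by (simp add: u_def image_constant_conv)
      qed
      ultimately have "u \<in> A" by (simp add: A_def)
      then show ?thesis using le by (auto simp: P_def)
    qed
  qed
  then obtain m where m: "m \<in> A" and min: "\<And>a. a \<in> A \<Longrightarrow> P m a \<Longrightarrow> a = m" by blast
  have mS: "sublinear_on V m" using m by (simp add: A_def)
  have odd: "m (- x) = - m x" if x: "x \<in> V" for x
  proof -
    obtain q where q: "sublinear_on V q" "\<And>x. x \<in> V \<Longrightarrow> q x \<le> m x" "q (- x) \<le> - m x"
      using sublinear_on_lower[OF V mS x] by blast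
    define r where "r x = (if x \<in> V then q x else 0)" for x
    have "r \<in> A" unfolding r_def using q(1,2) m
      by (intro restrict) (auto simp: A_def intro: order.trans)
    moreover have "P m r" using q(2) m by (auto simp: P_def r_def A_def)
    ultimately have "r = m" by (rule min)
    then have "m (- x) = r (- x)" by simp
    also have "\<dots> = q (- x)" using x V by (simp add: r_def subspace_neg)
    finally have "m (- x) \<le> - m x" using q(3) by simp
    then show ?thesis using sublinear_on_minus[OF V mS x] by linarith
  qed
  show thesis
  proof (rule that[of m])
    fix x y assume xy: "x \<in> V" "y \<in> V"
    then have "m (- x + - y) \<le> m (- x) + m (- y)"
      by (intro sublinear_onD(1)[OF mS] subspace_neg V)
    moreover have "m (- x + - y) = - m (x + y)" using odd[of "x + y"] xy Vadd by simp
    ultimately show "m (x + y) = m x + m y"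
      using odd xy sublinear_onD(1)[OF mS xy] by simp
  next
    fix x and c :: real assume x: "x \<in> V"
    show "m (c *\<^sub>R x) = c * m x"
    proof (cases "c \<ge> 0")
      case False
      then have "m ((- c) *\<^sub>R x) = - c * m x" using sublinear_onD(2)[OF mS x, of "- c"] by simp
      then show ?thesis using odd[of "c *\<^sub>R x"] Vsc[OF x, of c] by simp
    qed (use sublinear_onD(2)[OF mS x] in auto)
  next
    fix x assume "x \<in> V"
    then show "m x \<le> p x" using m by (auto simp: A_def)
  qed
qed

text \<open>Lowering \<open>p\<close> first takes the place of an extension from the line through
  \<open>x0\<close>: \<open>f (- x0) \<le> q (- x0) \<le> - p x0\<close> leaves only equality at
  \<open>x0\<close>.\<close>

lemma Hahn_Banach_attained:
  assumes V: "subspace V" and p: "sublinear_on V p" and x0: "x0 \<in> V"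
  obtains f where "\<And>x y. x \<in> V \<Longrightarrow> y \<in> V \<Longrightarrow> f (x + y) = f x + f y"
    "\<And>x c. x \<in> V \<Longrightarrow> f (c *\<^sub>R x) = c * f x" "\<And>x. x \<in> V \<Longrightarrow> f x \<le> p x" "f x0 = p x0"
proof -
  obtain q where q: "sublinear_on V q" "\<And>x. x \<in> V \<Longrightarrow> q x \<le> p x" "q (- x0) \<le> - p x0"
    using sublinear_on_lower[OF V p x0] by blast
  obtain f where f: "\<And>x y. x \<in> V \<Longrightarrow> y \<in> V \<Longrightarrow> f (x + y) = f x + f y"
    "\<And>x c. x \<in> V \<Longrightarrow> f (c *\<^sub>R x) = c * f x" "\<And>x. x \<in> V \<Longrightarrow> f x \<le> q x"
    using minimal_sublinear_linear[OF V q(1)] by blast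
  have le: "f x \<le> p x" if "x \<in> V" for x using f(3)[OF that] q(2)[OF that] by simp
  have "f (- x0) = - f x0" using f(2)[OF x0, of "- 1"] by simp
  then have "p x0 \<le> f x0" using f(3)[of "- x0"] q(3) x0 V by (simp add: subspace_neg)
  then show thesis using that[OF f(1,2) le] le[OF x0] by force
qed

section \<open>Continuous linear functionals from gauges\<close>

lemma tendsto_scaleR_const:
  fixes x :: "'a::locally_convex_space"
  assumes "(f \<longlongrightarrow> x) F"
  shows "((\<lambda>i. c *\<^sub>R f i) \<longlongrightarrow> c *\<^sub>R x) F"
proof -
  have "filterlim (\<lambda>i. (c, f i)) (nhds c \<times>\<^sub>F nhds x) F"
    using assms by (intro filterlim_Pair tendsto_const)
  from filterlim_compose[OF tendsto_scaleR_Pair this] show ?thesis by simp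
qed

lemma tendsto_scaleR_left:
  fixes x :: "'a::locally_convex_space"
  assumes "(c \<longlongrightarrow> l) F"
  shows "((\<lambda>i. c i *\<^sub>R x) \<longlongrightarrow> l *\<^sub>R x) F"
proof -
  have "filterlim (\<lambda>i. (c i, x)) (nhds l \<times>\<^sub>F nhds x) F"
    using assms by (intro filterlim_Pair tendsto_const)
  from filterlim_compose[OF tendsto_scaleR_Pair this] show ?thesis by simp
qed

text \<open>The functional is dominated by the gauge of a convex neighbourhood of \<open>0\<close> that misses
  \<open>w\<close>; the gauge of \<open>w\<close> is at least \<open>1\<close>.\<close>

lemma continuous_linear_functional_nonzero:
  fixes w :: "'a::locally_convex_space"
  assumes "w \<noteq> 0"
  obtains f :: "'a \<Rightarrow> real"
    where "linear f" "continuous_on UNIV f" "f w \<noteq> 0"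
proof -
  obtain U where U: "open U" "0 \<in> U" "w \<notin> U"
    using assms separation_t1[of 0 w] by metis
  from open_convex_nhd_0[OF U(1,2)]
  obtain V where V: "open V" "0 \<in> V" "V \<subseteq> U"
    and V_convex: "\<forall>x\<in>V. \<forall>y\<in>V. \<forall>s\<ge>0. \<forall>t\<ge>0. s + t = 1 \<longrightarrow> s *\<^sub>R x + t *\<^sub>R y \<in> V"
    by (elim exE conjE)
  have cvx: "s *\<^sub>R x + t *\<^sub>R y \<in> V"
    if "x \<in> V" "y \<in> V" "s \<ge> 0" "t \<ge> 0" "s + t = 1" for x y s t
    using V_convex that by simp
  define T where "T x = {t. t > 0 \<and> (1 / t) *\<^sub>R x \<in> V}" for x
  define p where "p x = Inf (T x)" for x
  have T_nonempty: "T x \<noteq> {}" for x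
  proof -
    \<comment> \<open>\<open>V\<close> is absorbing, because small multiples of \<open>x\<close>
      tend to 0.\<close>
    have "((\<lambda>n. (1 / real (Suc n)) *\<^sub>R x) \<longlongrightarrow> 0 *\<^sub>R x) sequentially"
      by (intro tendsto_scaleR_left LIMSEQ_Suc lim_1_over_n)
    then have "eventually (\<lambda>n. (1 / real (Suc n)) *\<^sub>R x \<in> V) sequentially"
      using V(1,2) by (intro topological_tendstoD) auto
    then obtain n where "(1 / real (Suc n)) *\<^sub>R x \<in> V"
      by (auto simp: eventually_sequentially)
    then show ?thesis by (auto simp: T_def intro!: exI[of _ "real (Suc n)"])
  qed
  have bdd: "bdd_below (T x)" for x by (auto simp: T_def bdd_below_def intro: less_imp_le)
  have p_le: "p x \<le> t" if "t \<in> T x" for t x unfolding p_def by (intro cInf_lower that bdd)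
  have p_ge: "a \<le> p x" if "\<And>t. t \<in> T x \<Longrightarrow> a \<le> t" for a x
    unfolding p_def by (intro cInf_greatest that T_nonempty)
  have T_add: "s + t \<in> T (x + y)" if "s \<in> T x" "t \<in> T y" for s t x y
  proof -
    have st: "s > 0" "t > 0" "(1 / s) *\<^sub>R x \<in> V" "(1 / t) *\<^sub>R y \<in> V" using that by (auto simp: T_def)
    \<comment> \<open>With weights proportional to \<open>s\<close> and \<open>t\<close> the
      combination is \<open>(1 / (s + t)) *\<^sub>R (x + y)\<close>.\<close>
    have "(s / (s + t)) *\<^sub>R ((1 / s) *\<^sub>R x) + (t / (s + t)) *\<^sub>R ((1 / t) *\<^sub>R y) \<in> V"
      using st by (intro cvx) (auto simp: add_divide_distrib[symmetric])
    then show ?thesis using st by (simp add: T_def scaleR_add_right)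
  qed
  have T_scale: "c * t \<in> T (c *\<^sub>R x)" if "t \<in> T x" "c > 0" for c t x
    using that by (auto simp: T_def)
  have "sublinear_on UNIV p"
  proof (rule sublinear_onI)
    show "p 0 = 0"
    proof (rule antisym)
      have "p 0 \<le> t" if "t > 0" for t
        using p_le[of t 0] that V(2) by (simp add: T_def)
      then show "p 0 \<le> 0" by (rule field_le_epsilon) auto
    qed (auto intro!: p_ge simp: T_def)
    fix x y :: 'a
    have *: "p (x + y) \<le> s + t" if "s \<in> T x" "t \<in> T y" for s t
      using p_le T_add that by blast
    have "p (x + y) - t \<le> p x" if "t \<in> T y" for t
      using *[OF _ that] by (intro p_ge) (simp add: algebra_simps)
    then have "p (x + y) - p x \<le> p y" by (intro p_ge) (simp add: algebra_simps)
    then show "p (x + y) \<le> p x + p y" by simp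
  next
    fix x :: 'a and c :: real assume c: "c > 0"
    have "p (c *\<^sub>R x) / c \<le> p x"
      using p_le[OF T_scale[OF _ c]] c by (intro p_ge) (simp add: field_simps)
    then show "p (c *\<^sub>R x) \<le> c * p x" using c by (simp add: field_simps)
  qed auto
  then obtain f where f: "\<And>x y. f (x + y) = f x + f y" "\<And>c x. f (c *\<^sub>R x) = c * f x"
      "\<And>x. f x \<le> p x" "f w = p w"
    using Hahn_Banach_attained[of UNIV p w] subspace_UNIV UNIV_I by metis
  have f_less: "f x \<le> e" if "e > 0" "(1 / e) *\<^sub>R x \<in> V" for e x
    using f(3)[of x] p_le[of e x] that by (simp add: T_def)
  have f_diff: "f (x - y) = f x - f y" for x y
    using f(1)[of x "(-1) *\<^sub>R y"] f(2)[of "-1" y] by simp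
  have "(f \<longlongrightarrow> f y) (nhds y)" for y
  proof (rule tendstoI)
    fix e :: real assume e: "e > 0"
    have ev: "eventually (\<lambda>x. (c / e) *\<^sub>R (x - y) \<in> V) (nhds y)" for c
    proof -
      have "((\<lambda>x. (c / e) *\<^sub>R (x - y)) \<longlongrightarrow> (c / e) *\<^sub>R (y - y)) (nhds y)"
        by (intro tendsto_scaleR_const tendsto_diff tendsto_const filterlim_ident)
      then show ?thesis using V(1,2) by (intro topological_tendstoD) auto
    qed
    \<comment> \<open>\<open>V\<close> need not be symmetric and the gauge bounds \<open>f\<close>
      only from above, so both signs of \<open>x - y\<close> are controlled. The factor 2 leaves
      \<open>e / 2\<close>, strictly below \<open>e\<close>.\<close>
    have "eventually (\<lambda>x. (2 / e) *\<^sub>R (x - y) \<in> V \<and> (- 2 / e) *\<^sub>R (x - y) \<in> V) (nhds y)"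
      by (intro eventually_conj ev)
    then show "eventually (\<lambda>x. dist (f x) (f y) < e) (nhds y)"
    proof eventually_elim
      case (elim x)
      have "f (x - y) \<le> e / 2"
        using elim e by (intro f_less) auto
      moreover have "f (y - x) \<le> e / 2"
        using elim e by (intro f_less) (auto simp: scaleR_diff_right)
      ultimately show ?case using e by (simp add: f_diff dist_real_def abs_le_iff)
    qed
  qed
  then have "continuous_on UNIV f"
    unfolding continuous_on_def by (auto intro: tendsto_mono[OF at_le] simp: tendsto_at_within_iff_tendsto_nhds)
  moreover have "p w \<ge> 1"
  proof (rule p_ge, rule ccontr)
    fix t assume t: "t \<in> T w" "\<not> 1 \<le> t"
    \<comment> \<open>For \<open>t < 1\<close> the point \<open>w\<close> would lie between 0 and
      \<open>(1 / t) *\<^sub>R w\<close>, hence in \<open>V\<close>.\<close>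
    then have "t *\<^sub>R ((1 / t) *\<^sub>R w) + (1 - t) *\<^sub>R 0 \<in> V"
      using V(2) by (intro cvx) (auto simp: T_def)
    then show False using t U(3) V(3) by (auto simp: T_def)
  qed
  moreover have "linear f" using f by (intro linearI) auto
  ultimately show thesis using f(4) by (intro that[of f]) auto
qed

section \<open>Continuous affine functions\<close>

lemma A_c_continuous: "a \<in> A_c X \<Longrightarrow> continuous_on X a"
  by (simp add: A_c_def)

lemma A_c_affine:
  "a \<in> A_c X \<Longrightarrow> x \<in> X \<Longrightarrow> y \<in> X \<Longrightarrow> 0 \<le> t \<Longrightarrow> t \<le> 1 \<Longrightarrow>
    a ((1 - t) *\<^sub>R x + t *\<^sub>R y) = (1 - t) * a x + t * a y"
  by (simp add: A_c_def)

lemma A_c_const: "(\<lambda>_. c) \<in> A_c X"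
  by (auto simp: A_c_def algebra_simps)

lemma A_c_add: "a \<in> A_c X \<Longrightarrow> b \<in> A_c X \<Longrightarrow> (\<lambda>x. a x + b x) \<in> A_c X"
  by (simp add: A_c_def continuous_on_add) (simp add: distrib_left)

lemma A_c_scale: "a \<in> A_c X \<Longrightarrow> (\<lambda>x. c * a x) \<in> A_c X"
  by (simp add: A_c_def continuous_on_mult_left) (simp add: distrib_left mult.left_commute)

lemma A_c_separates:
  fixes y z :: "'a::locally_convex_space"
  assumes "y \<noteq> z"
  obtains a where "a \<in> A_c X" "a y \<noteq> a z"
proof -
  have "y - z \<noteq> 0" using assms by simp
  then obtain f :: "'a \<Rightarrow> real" where f: "linear f" "continuous_on UNIV f" "f (y - z) \<noteq> 0"
    by (rule continuous_linear_functional_nonzero)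
  then show thesis
    by (intro that[of f])
      (auto simp: A_c_def linear_add linear_scale linear_diff intro: continuous_on_subset)
qed

text \<open>Bauer's minimum principle: the minimisers form an extreme closed set, and a minimal such
  set is a single point because \<open>A_c\<close> separates points.\<close>

lemma A_c_minimum_principle:
  fixes X :: "'a::locally_convex_space set"
  assumes X: "compact X" and h: "h \<in> A_c X" and c: "\<And>x. x \<in> ext X \<Longrightarrow> c \<le> h x" and x: "x \<in> X"
  shows "c \<le> h x"
proof -
  define extreme where "extreme F \<longleftrightarrow> F \<noteq> {} \<and> closed F \<and> F \<subseteq> X \<and>
    (\<forall>y\<in>X. \<forall>z\<in>X. \<forall>t. 0 < t \<longrightarrow> t < 1 \<longrightarrow> (1 - t) *\<^sub>R y + t *\<^sub>R z \<in> F \<longrightarrow> y \<in> F \<and> z \<in> F)" for F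
  have ext_props: "F \<noteq> {}" "closed F" "F \<subseteq> X" if "extreme F" for F
    using that by (simp_all add: extreme_def)
  have ext_segment: "y \<in> F \<and> z \<in> F"
    if "extreme F" "y \<in> X" "z \<in> X" "0 < t" "t < 1" "(1 - t) *\<^sub>R y + t *\<^sub>R z \<in> F" for F y z t
    using that unfolding extreme_def by blast
  have minimisers: "\<exists>e\<in>F. extreme {y\<in>F. a y = a e} \<and> (\<forall>y\<in>F. a e \<le> a y)"
    if F: "extreme F" and a: "a \<in> A_c X" for F a
  proof -
    note FX = ext_props[OF F]
    have cont: "continuous_on F a" using A_c_continuous[OF a] FX continuous_on_subset by blast
    have "compact F" using compact_Int_closed[OF X FX(2)] FX(3) by (simp add: Int_absorb1)
    then obtain e where e: "e \<in> F" "\<And>y. y \<in> F \<Longrightarrow> a e \<le> a y"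
      using continuous_attains_inf[OF _ FX(1) cont] by blast
    have step: "y \<in> F \<and> z \<in> F \<and> a y = a e \<and> a z = a e"
      if "y \<in> X" "z \<in> X" "0 < t" "t < 1" "(1 - t) *\<^sub>R y + t *\<^sub>R z \<in> F"
        "a ((1 - t) *\<^sub>R y + t *\<^sub>R z) = a e" for y z t
    proof -
      have yz: "y \<in> F" "z \<in> F" using ext_segment[OF F that(1-5)] by auto
      have 1: "(1 - t) * a y + t * a z = a e" using A_c_affine[OF a that(1,2)] that by simp
      \<comment> \<open>Weighted excesses over the minimum: they are nonnegative and sum to 0, so
        both end points are minimisers.\<close>
      have "0 \<le> (1 - t) * (a y - a e)" "0 \<le> t * (a z - a e)"
        using e(2) yz that by auto
      moreover have "(1 - t) * (a y - a e) + t * (a z - a e) = 0"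
        using 1 by (simp add: algebra_simps)
      ultimately have "(1 - t) * (a y - a e) = 0 \<and> t * (a z - a e) = 0"
        by (simp only: add_nonneg_eq_0_iff)
      then show ?thesis using yz that by auto
    qed
    have "closed {y\<in>F. a y = a e}" by (intro continuous_closed_preimage_constant cont FX)
    then have "extreme {y\<in>F. a y = a e}"
      unfolding extreme_def
    proof (intro conjI ballI allI impI)
      fix y z t
      assume "y \<in> X" "z \<in> X" "0 < t" "t < 1" "(1 - t) *\<^sub>R y + t *\<^sub>R z \<in> {y\<in>F. a y = a e}"
      then show "y \<in> {y\<in>F. a y = a e}" "z \<in> {y\<in>F. a y = a e}"
        using step by blast+
    qed (use e(1) FX in auto)
    then show ?thesis using e by (intro bexI[of _ e]) auto
  qed
  have "extreme X" using X x by (auto simp: extreme_def compact_imp_closed)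
  then obtain e0 where e0: "e0 \<in> X" "extreme {y\<in>X. h y = h e0}" "\<forall>y\<in>X. h e0 \<le> h y"
    using minimisers[OF _ h] by auto
  \<comment> \<open>The search stays inside the minimisers of \<open>h\<close>, so that the extreme
    point found also minimises \<open>h\<close> on \<open>X\<close>.\<close>
  define A where "A = {F. extreme F \<and> F \<subseteq> {y\<in>X. h y = h e0}}"
  have ex_min: "\<exists>m\<in>A. \<forall>a\<in>A. a \<subseteq> m \<longrightarrow> a = m"
  proof (rule predicate_Zorn[where P = "\<lambda>F G. G \<subseteq> F"])
    show "partial_order_on A (relation_of (\<lambda>F G. G \<subseteq> F) A)"
      by (rule partial_order_on_relation_ofI) auto
    fix C assume "C \<in> Chains (relation_of (\<lambda>F G. G \<subseteq> F) A)"
    then have CA: "C \<subseteq> A" and chain: "\<And>q r. q \<in> C \<Longrightarrow> r \<in> C \<Longrightarrow> q \<subseteq> r \<or> r \<subseteq> q"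
      by (auto simp: Chains_def relation_of_def)
    show "\<exists>u\<in>A. \<forall>a\<in>C. u \<subseteq> a"
    proof (cases "C = {}")
      case True
      then show ?thesis using e0(2) by (auto simp: A_def)
    next
      case False
      \<comment> \<open>A finite nonempty part of a chain contains its own intersection, so
        compactness keeps the whole intersection nonempty.\<close>
      have "X \<inter> \<Inter>C \<noteq> {}"
      proof (rule compact_imp_fip[OF X])
        show "closed T" if "T \<in> C" for T using that CA ext_props by (auto simp: A_def)
        fix F' assume F': "finite F'" "F' \<subseteq> C"
        show "X \<inter> \<Inter>F' \<noteq> {}"
        proof (cases "F' = {}")
          case False
          have "\<Inter>F' \<in> F'"
            by (rule Inter_in_chain[OF F'(1) False, of C])
              (use F'(2) chain in \<open>auto simp: subset.chain_def\<close>)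
          then have "\<Inter>F' \<subseteq> X" "\<Inter>F' \<noteq> {}" using F'(2) ext_props CA unfolding A_def by blast+
          then show ?thesis by blast
        qed (use x in auto)
      qed
      moreover have "closed (\<Inter>C)" using CA ext_props by (intro closed_Inter) (auto simp: A_def)
      moreover have "\<Inter>C \<subseteq> X" using CA False ext_props unfolding A_def by blast
      moreover have C_segment: "y \<in> \<Inter>C \<and> z \<in> \<Inter>C"
        if yz: "y \<in> X" "z \<in> X" "0 < t" "t < 1" "(1 - t) *\<^sub>R y + t *\<^sub>R z \<in> \<Inter>C" for y z t
      proof -
        have "y \<in> F \<and> z \<in> F" if F: "F \<in> C" for F
        proof -
          have "extreme F" using CA F by (auto simp: A_def)
          moreover have "(1 - t) *\<^sub>R y + t *\<^sub>R z \<in> F" using F yz(5) by blast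
          ultimately show ?thesis using ext_segment yz(1-4) by blast
        qed
        then show ?thesis by blast
      qed
      ultimately have "extreme (\<Inter>C)" unfolding extreme_def by blast
      then show ?thesis using CA False by (intro bexI[of _ "\<Inter>C"]) (auto simp: A_def)
    qed
  qed
  obtain F where F: "extreme F" "F \<subseteq> {y\<in>X. h y = h e0}" and min: "\<And>G. extreme G \<Longrightarrow> G \<subseteq> F \<Longrightarrow> G = F"
  proof -
    from ex_min obtain F where F: "F \<in> A" "\<And>G. G \<in> A \<Longrightarrow> G \<subseteq> F \<Longrightarrow> G = F" by blast
    have "G = F" if "extreme G" "G \<subseteq> F" for G using F that unfolding A_def by blast
    then show thesis using F(1) by (intro that[of F]) (auto simp: A_def)
  qed
  obtain e where e: "e \<in> F" using ext_props(1)[OF F(1)] by blast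
  have "y = e" if y: "y \<in> F" for y
  proof (rule ccontr)
    assume "y \<noteq> e"
    then obtain a where a: "a \<in> A_c X" "a y \<noteq> a e" by (rule A_c_separates)
    obtain e' where "extreme {y\<in>F. a y = a e'}" using minimisers[OF F(1) a(1)] by blast
    then have "{y\<in>F. a y = a e'} = F" by (rule min) auto
    then have "a y = a e'" "a e = a e'" using y e by blast+
    then show False using a(2) by simp
  qed
  then have Fe: "F = {e}" using e by blast
  have "e extreme_point_of X"
    unfolding extreme_point_of_def
  proof (intro conjI ballI notI)
    show "e \<in> X" using e ext_props(3)[OF F(1)] by blast
    fix a b assume ab: "a \<in> X" "b \<in> X" "e \<in> open_segment a b"
    then obtain t where t: "0 < t" "t < 1" "e = (1 - t) *\<^sub>R a + t *\<^sub>R b" "a \<noteq> b" by (auto simp: in_segment)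
    then have "a \<in> F \<and> b \<in> F" using ext_segment[OF F(1) ab(1,2)] e by blast
    then show False using Fe t(4) by auto
  qed
  then have "c \<le> h e" using c by (simp add: ext_def)
  also have "h e = h e0" using F(2) e by auto
  also have "h e0 \<le> h x" using e0(3) x by auto
  finally show ?thesis .
qed

section \<open>Barycenters of probability measures\<close>

lemma continuous_on_borel_measurable:
  fixes f :: "'a::topological_space \<Rightarrow> real"
  assumes "sets M = sets (restrict_space borel X)" "continuous_on X f"
  shows "f \<in> borel_measurable M"
  by (subst measurable_cong_sets[OF assms(1) refl])
    (rule borel_measurable_continuous_on_restrict[OF assms(2)])

lemma integrable_continuous_on_compact:
  fixes f :: "'a::topological_space \<Rightarrow> real"
  assumes M: "finite_measure M" "space M = X" "sets M = sets (restrict_space borel X)"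
    and X: "compact X" and f: "continuous_on X f"
  shows "integrable M f"
proof -
  interpret finite_measure M by fact
  have "bounded (f ` X)" using compact_continuous_image[OF f X] compact_imp_bounded by blast
  then obtain B where "\<And>x. x \<in> X \<Longrightarrow> \<bar>f x\<bar> \<le> B" by (auto simp: bounded_iff)
  then show ?thesis
    using M by (intro integrable_const_bound[of _ B] continuous_on_borel_measurable[OF M(3) f]) auto
qed

text \<open>Finitely many equations \<open>a x = \<integral> a \<partial>M\<close> are solved by a minimiser of the sum of squared
  errors: integrating its first-order optimality condition shows that the errors vanish.\<close>

lemma represents_finite:
  fixes X :: "'a::locally_convex_space set"
  assumes M: "prob_space M" "space M = X" "sets M = sets (restrict_space borel X)"
    and X: "compact X" "convex X" and I: "finite I" "I \<subseteq> A_c X"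
  shows "\<exists>x\<in>X. \<forall>a\<in>I. a x = (\<integral>y. a y \<partial>M)"
proof -
  interpret prob_space M by fact
  define m where "m a = (\<integral>y. a y \<partial>M)" for a :: "'a \<Rightarrow> real"
  have int: "integrable M a" if "a \<in> I" for a
    using that I(2) A_c_continuous integrable_continuous_on_compact[OF _ M(2,3) X(1)] finite_measure_axioms by blast
  have "continuous_on X (\<lambda>x. \<Sum>a\<in>I. (a x - m a)\<^sup>2)"
    using I A_c_continuous by (intro continuous_intros) blast
  moreover have "X \<noteq> {}" using not_empty M(2) by simp
  ultimately obtain x0 where x0: "x0 \<in> X" and min: "\<And>y. y \<in> X \<Longrightarrow> (\<Sum>a\<in>I. (a x0 - m a)\<^sup>2) \<le> (\<Sum>a\<in>I. (a y - m a)\<^sup>2)"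
    using continuous_attains_inf[OF X(1)] by blast
  define d where "d a = a x0 - m a" for a
  have pos: "0 \<le> (\<Sum>a\<in>I. d a * (a y - a x0))" if y: "y \<in> X" for y
  proof (rule ccontr)
    define s where "s = (\<Sum>a\<in>I. d a * (a y - a x0))"
    define q where "q = (\<Sum>a\<in>I. (a y - a x0)\<^sup>2)"
    assume "\<not> ?thesis"
    then have s: "s < 0" by (simp add: s_def)
    have q0: "q \<ge> 0" by (simp add: q_def sum_nonneg)
    \<comment> \<open>Comparison with the point at parameter \<open>t\<close> on the segment to
      \<open>y\<close>: the sum of squares changes by \<open>t * (2 * s + t * q)\<close>.\<close>
    have *: "0 \<le> 2 * s + t * q" if t: "0 < t" "t \<le> 1" for t
    proof -
      have "(1 - t) *\<^sub>R x0 + t *\<^sub>R y \<in> X" using X(2) x0 y t by (auto simp: convex_alt)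
      then have "(\<Sum>a\<in>I. (d a)\<^sup>2) \<le> (\<Sum>a\<in>I. (a ((1 - t) *\<^sub>R x0 + t *\<^sub>R y) - m a)\<^sup>2)"
        using min by (simp add: d_def)
      also have "\<dots> = (\<Sum>a\<in>I. (d a)\<^sup>2 + 2 * t * (d a * (a y - a x0)) + t\<^sup>2 * (a y - a x0)\<^sup>2)"
      proof (rule sum.cong[OF refl])
        fix a assume "a \<in> I"
        then have "a ((1 - t) *\<^sub>R x0 + t *\<^sub>R y) - m a = d a + t * (a y - a x0)"
          using A_c_affine[of a X x0 y t] x0 y t I(2) by (auto simp: d_def algebra_simps)
        then show "(a ((1 - t) *\<^sub>R x0 + t *\<^sub>R y) - m a)\<^sup>2 = (d a)\<^sup>2 + 2 * t * (d a * (a y - a x0)) + t\<^sup>2 * (a y - a x0)\<^sup>2"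
          by (simp only:) (simp add: power2_eq_square algebra_simps)
      qed
      also have "\<dots> = (\<Sum>a\<in>I. (d a)\<^sup>2) + 2 * t * s + t\<^sup>2 * q"
        by (simp add: s_def q_def sum.distrib sum_distrib_left)
      also have "\<dots> = (\<Sum>a\<in>I. (d a)\<^sup>2) + t * (2 * s + t * q)"
        by (simp add: power2_eq_square algebra_simps)
      finally have "0 \<le> t * (2 * s + t * q)" by simp
      then show ?thesis using t by (simp add: zero_le_mult_iff)
    qed
    \<comment> \<open>Chosen so that \<open>t * q \<le> - s\<close>, whence
      \<open>2 * s + t * q \<le> s < 0\<close>; adding 1 to \<open>q\<close> avoids a division by
      0.\<close>
    define t where "t = min 1 (- s / (q + 1))"
    have t: "0 < t" "t \<le> 1" using s q0 by (auto simp: t_def divide_neg_pos)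
    have "t * q \<le> - s / (q + 1) * q" using q0 by (intro mult_right_mono) (auto simp: t_def)
    also have "\<dots> \<le> - s" using s q0 by (simp add: divide_simps algebra_simps)
    finally show False using *[OF t] s by simp
  qed
  have "0 \<le> (\<integral>y. (\<Sum>a\<in>I. d a * (a y - a x0)) \<partial>M)"
    using pos M(2) by (intro integral_nonneg_AE) auto
  also have "\<dots> = (\<Sum>a\<in>I. d a * (m a - a x0))"
    using int by (simp add: m_def prob_space)
  also have "\<dots> = - (\<Sum>a\<in>I. (d a)\<^sup>2)"
    by (simp add: d_def power2_eq_square algebra_simps sum_negf[symmetric])
  finally have "(\<Sum>a\<in>I. (d a)\<^sup>2) = 0" using sum_nonneg[of I "\<lambda>a. (d a)\<^sup>2"] by simp
  then have "\<forall>a\<in>I. d a = 0" using I(1) by (simp add: sum_nonneg_eq_0_iff)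
  then show ?thesis using x0 by (auto simp: d_def m_def)
qed

text \<open>\<open>A_c X\<close> separates points, so a representing point is the only one.\<close>

lemma has_barycenter_iff_represents:
  fixes X :: "'a::locally_convex_space set"
  shows "has_barycenter X M x \<longleftrightarrow> represents X M x"
proof -
  have "y = x" if "represents X M x" "represents X M y" for y
  proof (rule ccontr)
    assume "y \<noteq> x"
    then obtain a where "a \<in> A_c X" "a y \<noteq> a x" by (rule A_c_separates)
    then show False using that by (auto simp: represents_def)
  qed
  then show ?thesis unfolding has_barycenter_def by blast
qed

text \<open>The condition on a single \<open>a\<close> defines a closed subset of the compact
  \<open>X\<close>, so it is enough to meet finitely many conditions at a time. Formulated for Borel
  probabilities, the result applies directly to conditioned measures.\<close>

lemma has_barycenter_exists:
  fixes X :: "'a::locally_convex_space set"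
  assumes M: "prob_space M" "space M = X" "sets M = sets (restrict_space borel X)"
    and X: "compact X" "convex X"
  obtains x where "has_barycenter X M x"
proof -
  have "X \<inter> (\<Inter>a\<in>A_c X. {x\<in>X. a x = (\<integral>y. a y \<partial>M)}) \<noteq> {}"
  proof (rule compact_imp_fip_image[OF X(1)])
    show "closed {x\<in>X. a x = (\<integral>y. a y \<partial>M)}" if "a \<in> A_c X" for a
      using A_c_continuous[OF that] X(1)
      by (intro continuous_closed_preimage_constant compact_imp_closed)
    show "X \<inter> (\<Inter>a\<in>I. {x\<in>X. a x = (\<integral>y. a y \<partial>M)}) \<noteq> {}" if "finite I" "I \<subseteq> A_c X" for I
      using represents_finite[OF M X that] by auto
  qed
  then obtain x where x: "x \<in> X" "\<And>a. a \<in> A_c X \<Longrightarrow> a x = (\<integral>y. a y \<partial>M)" by auto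
  then have "has_barycenter X M x" by (simp add: has_barycenter_iff_represents represents_def)
  then show thesis by (rule that)
qed

section \<open>Riesz representation on compact Hausdorff spaces\<close>

text \<open>The ambient space is merely Hausdorff, so normality comes from the compact subspace
  \<open>X\<close>; accordingly disjointness and the values of \<open>h\<close> concern
  \<open>X\<close> only.\<close>

lemma Urysohn_compact:
  fixes X :: "'a::t2_space set"
  assumes X: "compact X" and CD: "closed C" "closed D" "X \<inter> C \<inter> D = {}"
  obtains h :: "'a \<Rightarrow> real" where "continuous_on X h" "\<And>x. x \<in> X \<Longrightarrow> 0 \<le> h x \<and> h x \<le> 1"
    "\<And>x. x \<in> X \<Longrightarrow> x \<in> C \<Longrightarrow> h x = 0" "\<And>x. x \<in> X \<Longrightarrow> x \<in> D \<Longrightarrow> h x = 1"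
proof -
  have "Hausdorff_space (euclidean :: 'a topology)"
    unfolding Hausdorff_space_def using hausdorff by (fastforce simp: disjnt_def)
  then have "normal_space (top_of_set X)"
    using X by (intro compact_Hausdorff_or_regular_imp_normal_space)
      (auto intro: Hausdorff_space_subtopology compact_space_subtopology)
  moreover have "closedin (top_of_set X) (X \<inter> C)" "closedin (top_of_set X) (X \<inter> D)"
    using CD by (auto intro: closedin_closed_Int)
  moreover have "disjnt (X \<inter> C) (X \<inter> D)" using CD(3) by (auto simp: disjnt_def)
  ultimately obtain h where h: "continuous_map (top_of_set X) (top_of_set {0..1::real}) h"
      "h ` (X \<inter> C) \<subseteq> {0}" "h ` (X \<inter> D) \<subseteq> {1}"
    using Urysohn_lemma[of "top_of_set X" "X \<inter> C" "X \<inter> D" 0 1] by auto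
  from h(1) have "continuous_on X h" "h ` X \<subseteq> {0..1}"
    by (auto simp: continuous_map_in_subtopology continuous_map_iff_continuous)
  then show thesis using h(2,3) by (intro that[of h]) auto
qed

section \<open>Positive normalised functionals and the content of open sets\<close>

locale state =
  fixes X :: "'a::t2_space set" and L :: "('a \<Rightarrow> real) \<Rightarrow> real"
  assumes compact_X: "compact X"
    and L_add: "continuous_on X f \<Longrightarrow> continuous_on X g \<Longrightarrow> L (\<lambda>x. f x + g x) = L f + L g"
    and L_scale: "continuous_on X f \<Longrightarrow> L (\<lambda>x. c * f x) = c * L f"
    and L_nonneg: "continuous_on X f \<Longrightarrow> (\<And>x. x \<in> X \<Longrightarrow> 0 \<le> f x) \<Longrightarrow> 0 \<le> L f"
    and L_one: "L (\<lambda>_. 1) = 1"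
begin

lemma L_diff:
  assumes "continuous_on X f" "continuous_on X g"
  shows "L (\<lambda>x. f x - g x) = L f - L g"
  using L_add[of f "\<lambda>x. (- 1) * g x"] L_scale[of g "- 1"] assms
  by (simp add: continuous_on_minus)

lemma L_mono:
  assumes "continuous_on X f" "continuous_on X g" "\<And>x. x \<in> X \<Longrightarrow> f x \<le> g x"
  shows "L f \<le> L g"
  using L_nonneg[of "\<lambda>x. g x - f x"] L_diff[OF assms(2,1)] assms
  by (simp add: continuous_on_diff)

lemma L_cong:
  assumes "continuous_on X f" "continuous_on X g" "\<And>x. x \<in> X \<Longrightarrow> f x = g x"
  shows "L f = L g"
  using L_mono[of f g] L_mono[of g f] assms by (simp add: order.antisym)

lemma L_const: "L (\<lambda>_. c) = c"
  using L_scale[of "\<lambda>_. 1" c] L_one by simp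

lemma L_sum:
  assumes "finite I" "\<And>i. i \<in> I \<Longrightarrow> continuous_on X (f i)"
  shows "L (\<lambda>x. \<Sum>i\<in>I. f i x) = (\<Sum>i\<in>I. L (f i))"
  using assms
proof (induction I)
  case empty
  then show ?case by (simp add: L_const)
next
  case (insert i I)
  then show ?case by (simp add: L_add continuous_on_sum)
qed

text \<open>Vanishing off \<open>U\<close> stands in for having support in \<open>U\<close>. Where a
  closed set inside \<open>U\<close> is wanted, a cutoff at level \<open>e > 0\<close> supplies the
  superlevel set, at a cost of at most \<open>e\<close> in \<open>L\<close>.\<close>

definition subordinate :: "'a set \<Rightarrow> ('a \<Rightarrow> real) set" where
  "subordinate U = {f. continuous_on X f \<and> (\<forall>x\<in>X. 0 \<le> f x \<and> f x \<le> 1 \<and> (x \<notin> U \<longrightarrow> f x = 0))}"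

definition content :: "'a set \<Rightarrow> real" where
  "content U = (SUP f\<in>subordinate U. L f)"

lemma subordinateD:
  assumes "f \<in> subordinate U"
  shows "continuous_on X f" "x \<in> X \<Longrightarrow> 0 \<le> f x" "x \<in> X \<Longrightarrow> f x \<le> 1"
    "x \<in> X \<Longrightarrow> x \<notin> U \<Longrightarrow> f x = 0"
  using assms by (auto simp: subordinate_def)

lemma subordinate_zero: "(\<lambda>_. 0) \<in> subordinate U"
  by (simp add: subordinate_def)

lemma L_le_1: "f \<in> subordinate U \<Longrightarrow> L f \<le> 1"
  using L_mono[of f "\<lambda>_. 1"] by (auto simp: subordinate_def L_one)

lemma L_le_content: "f \<in> subordinate U \<Longrightarrow> L f \<le> content U"
  unfolding content_def using L_le_1 by (intro cSUP_upper) (auto intro!: bdd_aboveI2)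

lemma content_le: "(\<And>f. f \<in> subordinate U \<Longrightarrow> L f \<le> c) \<Longrightarrow> content U \<le> c"
  unfolding content_def using subordinate_zero by (intro cSUP_least) auto

lemma content_approx:
  assumes "e > 0"
  obtains f where "f \<in> subordinate U" "content U - e < L f"
proof -
  have "\<exists>f\<in>subordinate U. content U - e < L f"
    using content_le[of U "content U - e"] assms by (rule_tac ccontr) (force simp: not_less)
  then show thesis using that by blast
qed

lemma content_nonneg: "0 \<le> content U"
  using L_le_content[OF subordinate_zero] by (simp add: L_const)

lemma content_mono:
  assumes "X \<inter> U \<subseteq> W"
  shows "content U \<le> content W"
proof (rule content_le)
  fix f assume "f \<in> subordinate U"
  then have "f \<in> subordinate W" using assms by (auto simp: subordinate_def)
  then show "L f \<le> content W" by (rule L_le_content)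
qed

lemma content_empty: "content {} = 0"
proof (rule antisym[OF content_le content_nonneg])
  fix f assume "f \<in> subordinate {}"
  then show "L f \<le> 0" using L_cong[of f "\<lambda>_. 0"] by (auto simp: subordinate_def L_const)
qed

lemma content_X: "X \<subseteq> U \<Longrightarrow> content U = 1"
  using L_le_content[of "\<lambda>_. 1" U] by (intro antisym content_le L_le_1) (auto simp: subordinate_def L_one)

lemma cutoff_subordinate:
  assumes "f \<in> subordinate U" "e \<ge> 0" "\<And>x. x \<in> X \<Longrightarrow> x \<notin> W \<Longrightarrow> f x \<le> e"
  shows "(\<lambda>x. max 0 (f x - e)) \<in> subordinate W"
  using assms by (fastforce simp: subordinate_def intro!: continuous_intros)

lemma cutoff_L:
  assumes "f \<in> subordinate U" "e \<ge> 0"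
  shows "L f \<le> L (\<lambda>x. max 0 (f x - e)) + e"
proof -
  have cont: "continuous_on X f" using assms(1) by (rule subordinateD)
  then have "L f \<le> L (\<lambda>x. max 0 (f x - e) + e)"
    by (intro L_mono) (auto intro!: continuous_intros)
  also have "\<dots> = L (\<lambda>x. max 0 (f x - e)) + L (\<lambda>_. e)"
    using cont by (intro L_add) (auto intro!: continuous_intros)
  finally show ?thesis by (simp add: L_const)
qed

lemma closed_superlevel:
  assumes "f \<in> subordinate U"
  shows "closed {x\<in>X. e \<le> f x}"
proof -
  have "closed (f -` {e..} \<inter> X)"
    using continuous_on_closed_vimage[OF compact_imp_closed[OF compact_X], of f] subordinateD(1)[OF assms] by auto
  also have "f -` {e..} \<inter> X = {x\<in>X. e \<le> f x}" by auto
  finally show ?thesis .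
qed

text \<open>The parts of \<open>C\<close> outside \<open>U\<close> and outside \<open>V\<close> are
  closed and disjoint. A Urysohn function \<open>h\<close> between them splits the cutoff as
  \<open>g * h + g * (1 - h)\<close>, one summand subordinate to \<open>U\<close> and the other to
  \<open>V\<close>.\<close>

lemma content_Un:
  assumes "open U" "open V"
  shows "content (U \<union> V) \<le> content U + content V"
proof (rule content_le, rule field_le_epsilon)
  fix f and e :: real assume f: "f \<in> subordinate (U \<union> V)" and e: "e > 0"
  define C where "C = {x\<in>X. e \<le> f x}"
  define g where "g = (\<lambda>x. max 0 (f x - e))"
  have "closed C" unfolding C_def by (rule closed_superlevel[OF f])
  then have "closed (C - U)" "closed (C - V)" using assms by (auto intro: closed_Diff)
  moreover have "X \<inter> (C - U) \<inter> (C - V) = {}"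
    using f e by (force simp: C_def subordinate_def)
  ultimately obtain h :: "'a \<Rightarrow> real" where h: "continuous_on X h" "\<And>x. x \<in> X \<Longrightarrow> 0 \<le> h x \<and> h x \<le> 1"
    "\<And>x. x \<in> X \<Longrightarrow> x \<in> C - U \<Longrightarrow> h x = 0" "\<And>x. x \<in> X \<Longrightarrow> x \<in> C - V \<Longrightarrow> h x = 1"
    using Urysohn_compact[OF compact_X] by blast
  have g: "g \<in> subordinate C"
    unfolding g_def using e f by (intro cutoff_subordinate[OF f]) (auto simp: C_def)
  have "(\<lambda>x. g x * h x) \<in> subordinate U"
    unfolding subordinate_def
  proof (intro CollectI conjI ballI impI)
    show "g x * h x = 0" if "x \<in> X" "x \<notin> U" for x
      using that h(3)[of x] subordinateD(4)[OF g, of x] by (cases "x \<in> C") auto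
  qed (use subordinateD[OF g] h in \<open>auto intro!: continuous_intros mult_le_one\<close>)
  moreover have "(\<lambda>x. g x * (1 - h x)) \<in> subordinate V"
    unfolding subordinate_def
  proof (intro CollectI conjI ballI impI)
    show "g x * (1 - h x) = 0" if "x \<in> X" "x \<notin> V" for x
      using that h(4)[of x] subordinateD(4)[OF g, of x] by (cases "x \<in> C") auto
  qed (use subordinateD[OF g] h in \<open>auto intro!: continuous_intros mult_le_one\<close>)
  ultimately have "L (\<lambda>x. g x * h x) \<le> content U" "L (\<lambda>x. g x * (1 - h x)) \<le> content V"
    by (auto intro: L_le_content)
  moreover have "L g = L (\<lambda>x. g x * h x + g x * (1 - h x))"
    by (intro arg_cong[where f = L]) (auto simp: algebra_simps)
  moreover have "\<dots> = L (\<lambda>x. g x * h x) + L (\<lambda>x. g x * (1 - h x))"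
    using subordinateD(1)[OF g] h(1) by (intro L_add continuous_intros)
  moreover have "L f \<le> L g + e"
    using cutoff_L[OF f, of e] e by (simp add: g_def)
  ultimately show "L f \<le> content U + content V + e" by linarith
qed

lemma content_UN:
  assumes "finite I" "\<And>i. i \<in> I \<Longrightarrow> open (U i)"
  shows "content (\<Union>i\<in>I. U i) \<le> (\<Sum>i\<in>I. content (U i))"
  using assms
proof (induction I)
  case empty
  then show ?case by (simp add: content_empty)
next
  case (insert i I)
  have "content (\<Union>i\<in>insert i I. U i) \<le> content (U i) + content (\<Union>i\<in>I. U i)"
    using content_Un[of "U i" "\<Union>i\<in>I. U i", OF _ open_UN] insert.prems by simp
  then show ?case using insert by (force simp: sum.insert)
qed

text \<open>The superlevel set of a nearly optimal function is compact, so finitely many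
  \<open>U i\<close> cover it and finite subadditivity applies. One half of \<open>e\<close> pays
  for near optimality, the other for the cutoff.\<close>

lemma content_countable_UN:
  fixes U :: "nat \<Rightarrow> 'a set"
  assumes U: "\<And>i. open (U i)"
  shows "ennreal (content (\<Union>i. U i)) \<le> (\<Sum>i. ennreal (content (U i)))"
proof (rule ennreal_le_epsilon)
  fix e :: real assume e: "e > 0"
  obtain f where f: "f \<in> subordinate (\<Union>i. U i)" "content (\<Union>i. U i) - e / 2 < L f"
    using content_approx[of "e / 2"] e by auto
  define C where "C = {x\<in>X. e / 2 \<le> f x}"
  have "compact C" unfolding C_def
    using compact_Int_closed[OF compact_X closed_superlevel[OF f(1), of "e / 2"]]
    by (simp add: Int_absorb1)
  moreover have "C \<subseteq> (\<Union>i. U i)" using f(1) e by (force simp: C_def subordinate_def)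
  ultimately obtain I where I: "finite I" "C \<subseteq> (\<Union>i\<in>I. U i)"
    using U by (metis compactE_image)
  have "(\<lambda>x. max 0 (f x - e / 2)) \<in> subordinate (\<Union>i\<in>I. U i)"
    using e f(1) I(2) by (intro cutoff_subordinate[OF f(1)]) (auto simp: C_def)
  then have "L (\<lambda>x. max 0 (f x - e / 2)) \<le> (\<Sum>i\<in>I. content (U i))"
    using L_le_content content_UN[OF I(1), of U] U order.trans by blast
  then have "content (\<Union>i. U i) \<le> (\<Sum>i\<in>I. content (U i)) + e"
    using cutoff_L[OF f(1), of "e / 2"] f(2) e by simp
  then have "ennreal (content (\<Union>i. U i)) \<le> ennreal ((\<Sum>i\<in>I. content (U i)) + e)"
    by (rule ennreal_leI)
  also have "\<dots> = (\<Sum>i\<in>I. ennreal (content (U i))) + ennreal e"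
    using e by (simp add: ennreal_plus sum_nonneg content_nonneg sum_ennreal)
  also have "(\<Sum>i\<in>I. ennreal (content (U i))) \<le> (\<Sum>i. ennreal (content (U i)))"
    using I(1) by (intro sum_le_suminf) auto
  finally show "ennreal (content (\<Union>i. U i)) \<le> (\<Sum>i. ennreal (content (U i))) + ennreal e"
    by (simp add: add_right_mono)
qed

text \<open>The harder half of Caratheodory's criterion, for an open test set \<open>W\<close>.
  Removing from \<open>W\<close> the superlevel set \<open>C\<close> of a nearly optimal
  \<open>f\<close> leaves the open set \<open>V\<close>. The cutoff \<open>f'\<close> vanishes off
  \<open>C\<close> and \<open>g\<close> vanishes on \<open>C\<close>, so \<open>f' + g\<close> stays
  at most 1. The three thirds of \<open>e\<close> pay for \<open>f\<close>, for \<open>g\<close> and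
  for the cutoff.\<close>

lemma content_split:
  assumes "open W" "open U" and e: "e > 0"
  obtains V where "open V" "X \<inter> W - U \<subseteq> V" "content (W \<inter> U) + content V \<le> content W + e"
proof -
  obtain f where f: "f \<in> subordinate (W \<inter> U)" "content (W \<inter> U) - e / 3 < L f"
    using content_approx[of "e / 3"] e by auto
  define C where "C = {x\<in>X. e / 3 \<le> f x}"
  have "closed C" unfolding C_def by (rule closed_superlevel[OF f(1)])
  obtain g where g: "g \<in> subordinate (W - C)" "content (W - C) - e / 3 < L g"
    using content_approx[of "e / 3"] e by auto
  define f' where "f' = (\<lambda>x. max 0 (f x - e / 3))"
  have f'C: "f' \<in> subordinate C"
    unfolding f'_def using e by (intro cutoff_subordinate[OF f(1)]) (auto simp: C_def)
  have f'W: "f' \<in> subordinate (W \<inter> U)"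
    unfolding f'_def using e subordinateD(4)[OF f(1)] by (intro cutoff_subordinate[OF f(1)]) auto
  have "(\<lambda>x. f' x + g x) \<in> subordinate W"
    unfolding subordinate_def
  proof (intro CollectI conjI ballI impI)
    show "f' x + g x \<le> 1" if "x \<in> X" for x
      using that subordinateD(2-4)[OF f'C, of x] subordinateD(2-4)[OF g(1), of x] by (cases "x \<in> C") auto
    show "f' x + g x = 0" if "x \<in> X" "x \<notin> W" for x
      using that subordinateD(4)[OF f'W, of x] subordinateD(4)[OF g(1), of x] by auto
  qed (use subordinateD[OF g(1)] subordinateD[OF f'C] in \<open>auto intro!: continuous_intros\<close>)
  then have "L (\<lambda>x. f' x + g x) \<le> content W" by (rule L_le_content)
  then have "L f' + L g \<le> content W"
    using L_add subordinateD(1)[OF f'C] subordinateD(1)[OF g(1)] by simp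
  then have "content (W \<inter> U) + content (W - C) \<le> content W + e"
    using cutoff_L[OF f(1), of "e / 3"] f(2) g(2) e unfolding f'_def by linarith
  moreover have "X \<inter> W - U \<subseteq> W - C"
    using subordinateD(4)[OF f(1)] e by (force simp: C_def)
  moreover have "open (W - C)" using assms(1) \<open>closed C\<close> by (rule open_Diff)
  ultimately show thesis by (intro that)
qed

section \<open>The outer measure and its restriction to Borel sets\<close>

definition outer :: "'a set \<Rightarrow> ennreal" where
  "outer A = (INF U\<in>{U. open U \<and> A \<subseteq> U}. ennreal (content U))"

lemma outer_le: "open U \<Longrightarrow> A \<subseteq> U \<Longrightarrow> outer A \<le> content U"
  unfolding outer_def by (intro INF_lower) auto

lemma outer_open:
  assumes "open U"
  shows "outer (X \<inter> U) = content U"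
proof (rule antisym)
  show "outer (X \<inter> U) \<le> content U" using assms by (intro outer_le) auto
  show "content U \<le> outer (X \<inter> U)"
    unfolding outer_def by (rule INF_greatest) (auto intro!: ennreal_leI content_mono)
qed

lemma outer_less_top: "outer A < top"
  using outer_le[of UNIV A] by (simp add: order.strict_trans1)

lemma outer_approx:
  assumes "e > 0"
  obtains U where "open U" "A \<subseteq> U" "ennreal (content U) \<le> outer A + ennreal e"
proof -
  have "outer A \<noteq> \<infinity>" using outer_less_top[of A] by auto
  from INF_approx_ennreal[OF assms outer_def this] obtain U
    where "open U" "A \<subseteq> U" "ennreal (content U) < outer A + ennreal e" by auto
  then show thesis by (intro that) auto
qed

lemma outer_measure_space_outer: "outer_measure_space (Pow X) outer"
  unfolding outer_measure_space_def
proof (intro conjI)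
  show "positive (Pow X) outer"
    using outer_open[of "{}"] by (simp add: positive_def content_empty)
  show "increasing (Pow X) outer"
    unfolding increasing_def outer_def by (intro ballI impI INF_superset_mono) auto
  show "countably_subadditive (Pow X) outer"
    unfolding countably_subadditive_def
  proof (intro allI impI)
    fix A :: "nat \<Rightarrow> 'a set"
    show "outer (\<Union>i. A i) \<le> (\<Sum>i. outer (A i))"
    proof (rule ennreal_le_epsilon)
      fix e :: real assume e: "e > 0"
      have "\<exists>U. open U \<and> A i \<subseteq> U \<and> ennreal (content U) \<le> outer (A i) + ennreal (e * (1/2) ^ Suc i)" for i
      proof -
        have "0 < e * (1/2) ^ Suc i" using e by simp
        then show ?thesis by (rule outer_approx) blast
      qed
      then obtain U where U: "\<And>i. open (U i)" "\<And>i. A i \<subseteq> U i"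
        "\<And>i. ennreal (content (U i)) \<le> outer (A i) + ennreal (e * (1/2) ^ Suc i)" by metis
      have "outer (\<Union>i. A i) \<le> ennreal (content (\<Union>i. U i))"
        using U(1,2) by (intro outer_le) auto
      also have "\<dots> \<le> (\<Sum>i. ennreal (content (U i)))" by (rule content_countable_UN[OF U(1)])
      also have "\<dots> \<le> (\<Sum>i. outer (A i) + ennreal (e * (1/2) ^ Suc i))"
        by (intro suminf_le U(3)) auto
      also have "\<dots> = (\<Sum>i. outer (A i)) + (\<Sum>i. ennreal (e * (1/2) ^ Suc i))"
        by (intro suminf_add[symmetric]) auto
      also have "(\<Sum>i. ennreal (e * (1/2) ^ Suc i)) = ennreal e"
        using sums_mult[OF power_half_series, of e] e by (intro suminf_ennreal_eq) auto
      finally show "outer (\<Union>i. A i) \<le> (\<Sum>i. outer (A i)) + ennreal e" .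
    qed
  qed
qed

lemma outer_Un_le:
  assumes "A \<subseteq> X" "B \<subseteq> X" "A \<inter> B = {}"
  shows "outer (A \<union> B) \<le> outer A + outer B"
proof -
  interpret sigma_algebra X "Pow X" by (rule sigma_algebra_Pow)
  have "subadditive (Pow X) outer"
    using outer_measure_space_outer
    by (intro countably_subadditive_subadditive) (auto simp: outer_measure_space_def)
  then show ?thesis using assms by (intro subadditiveD) auto
qed

text \<open>For open \<open>W\<close> containing \<open>A\<close>, \<open>content_split\<close>
  bounds the two pieces by \<open>content W\<close>; the infimum over \<open>W\<close> is
  \<open>outer A\<close>.\<close>

lemma open_in_lambda_system:
  assumes U: "open U"
  shows "X \<inter> U \<in> lambda_system X (Pow X) outer"
proof -
  interpret sigma_algebra X "Pow X" by (rule sigma_algebra_Pow)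
  have "outer (A \<inter> (X \<inter> U)) + outer (A - X \<inter> U) = outer A" if A: "A \<subseteq> X" for A
  proof (rule antisym)
    show "outer A \<le> outer (A \<inter> (X \<inter> U)) + outer (A - X \<inter> U)"
      using outer_Un_le[of "A \<inter> (X \<inter> U)" "A - X \<inter> U"] A by (simp add: Int_Diff_Un Int_Diff_disjoint le_infI1 subset_trans[OF Diff_subset])
    have "outer (A \<inter> (X \<inter> U)) + outer (A - X \<inter> U) \<le> content W" if W: "open W" "A \<subseteq> W" for W
    proof (rule ennreal_le_epsilon)
      fix e :: real assume e: "e > 0"
      obtain V where V: "open V" "X \<inter> W - U \<subseteq> V" "content (W \<inter> U) + content V \<le> content W + e"
        using content_split[OF W(1) U e] .
      have "outer (A \<inter> (X \<inter> U)) + outer (A - X \<inter> U) \<le> ennreal (content (W \<inter> U)) + ennreal (content V)"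
        using A V W U by (intro add_mono outer_le) auto
      also have "\<dots> \<le> ennreal (content W + e)"
        using V(3) by (simp add: ennreal_plus[symmetric] content_nonneg del: ennreal_plus) (auto intro: ennreal_leI)
      finally show "outer (A \<inter> (X \<inter> U)) + outer (A - X \<inter> U) \<le> ennreal (content W) + ennreal e"
        using e by (simp add: content_nonneg)
    qed
    then show "outer (A \<inter> (X \<inter> U)) + outer (A - X \<inter> U) \<le> outer A"
      unfolding outer_def[of A] by (intro INF_greatest) auto
  qed
  then show ?thesis by (auto simp: lambda_system_eq)
qed

definition riesz_measure :: "'a measure" where
  "riesz_measure = measure_of X (sets (restrict_space borel X)) outer"

lemma space_riesz: "space riesz_measure = X"
  and sets_riesz: "sets riesz_measure = sets (restrict_space borel X)"
proof -
  have "sets (restrict_space borel X) \<subseteq> Pow X"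
    using sets.space_closed[of "restrict_space borel X"] by (simp add: space_restrict_space)
  then show "space riesz_measure = X" "sets riesz_measure = sets (restrict_space borel X)"
    using sets.sigma_sets_eq[of "restrict_space borel X"]
    by (simp_all add: riesz_measure_def space_measure_of sets_measure_of space_restrict_space)
qed

text \<open>The sets whose trace on \<open>X\<close> is Caratheodory measurable include the open
  sets and are closed under complements and countable unions, so they include all Borel
  sets.\<close>

lemma emeasure_riesz:
  assumes "A \<in> sets (restrict_space borel X)"
  shows "emeasure riesz_measure A = outer A"
proof -
  interpret P: sigma_algebra X "Pow X" by (rule sigma_algebra_Pow)
  have ms: "measure_space X (lambda_system X (Pow X) outer) outer"
    by (rule P.caratheodory_lemma[OF outer_measure_space_outer])
  then interpret S: sigma_algebra X "lambda_system X (Pow X) outer" by (simp add: measure_space_def)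
  have "X \<inter> B \<in> lambda_system X (Pow X) outer" if "B \<in> sigma_sets UNIV {S. open S}" for B
    using that
  proof induction
    case (Compl B)
    have "X - X \<inter> B \<in> lambda_system X (Pow X) outer" using Compl.IH by (rule S.compl_sets)
    moreover have "X \<inter> (UNIV - B) = X - X \<inter> B" by auto
    ultimately show ?case by simp
  next
    case (Union B)
    have "(\<Union>i. X \<inter> B i) \<in> lambda_system X (Pow X) outer"
      using Union.IH by (intro S.countable_UN) auto
    then show ?case by simp
  qed (auto intro: open_in_lambda_system)
  then have sub: "sets (restrict_space borel X) \<subseteq> lambda_system X (Pow X) outer"
    by (auto simp: sets_restrict_space borel_def)
  have sa: "sigma_algebra X (sets (restrict_space borel X))"
    using sets.sigma_algebra_axioms[of "restrict_space borel X"] by (simp add: space_restrict_space)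
  from measure_down[OF ms sa sub]
  show ?thesis unfolding riesz_measure_def using assms
    by (intro emeasure_measure_of_sigma) (auto simp: measure_space_def)
qed

lemma emeasure_riesz_open:
  assumes "open U"
  shows "emeasure riesz_measure (X \<inter> U) = content U"
  using assms by (subst emeasure_riesz) (auto simp: outer_open sets_restrict_space)

lemma prob_space_riesz: "prob_space riesz_measure"
  using emeasure_riesz_open[of UNIV] by (intro prob_spaceI) (simp add: space_riesz content_X)

text \<open>Outer approximation by open sets is built into \<open>outer\<close>. Applied to
  \<open>X - A\<close> it gives an open \<open>U\<close>, and \<open>X - U\<close> is then a compact
  subset of \<open>A\<close> with nearly the same mass.\<close>

lemma radon_prob_riesz: "radon_prob X riesz_measure"
  unfolding radon_prob_def
proof (intro conjI ballI)
  interpret prob_space riesz_measure by (rule prob_space_riesz)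
  fix A assume A: "A \<in> sets riesz_measure"
  have AX: "A \<subseteq> X" using sets.sets_into_space[OF A] by (simp add: space_riesz)
  show "emeasure riesz_measure A = (SUP K\<in>{K. compact K \<and> K \<subseteq> A}. emeasure riesz_measure K)"
  proof (rule antisym)
    show "(SUP K\<in>{K. compact K \<and> K \<subseteq> A}. emeasure riesz_measure K) \<le> emeasure riesz_measure A"
      using A by (intro SUP_least emeasure_mono) auto
    show "emeasure riesz_measure A \<le> (SUP K\<in>{K. compact K \<and> K \<subseteq> A}. emeasure riesz_measure K)"
    proof (rule ennreal_le_epsilon)
      fix e :: real assume e: "e > 0"
      have Ac: "X - A \<in> sets riesz_measure" using A sets.compl_sets space_riesz by metis
      obtain U where U: "open U" "X - A \<subseteq> U" "ennreal (content U) \<le> outer (X - A) + ennreal e"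
        using outer_approx[OF e] .
      have XU: "X \<inter> U \<in> sets riesz_measure" using U(1) by (auto simp: sets_riesz sets_restrict_space)
      have K: "compact (X - U)" using compact_X U(1) by (rule compact_diff)
      have "emeasure riesz_measure (X \<inter> U) \<le> emeasure riesz_measure (X - A) + ennreal e"
        using U emeasure_riesz[of "X - A"] Ac by (simp add: emeasure_riesz_open sets_riesz)
      then have "measure riesz_measure (X \<inter> U) \<le> measure riesz_measure (X - A) + e"
        using e by (simp add: emeasure_eq_measure ennreal_plus[symmetric] del: ennreal_plus)
      moreover have "measure riesz_measure (X - A) = 1 - measure riesz_measure A"
        using prob_compl[OF A] by (simp add: space_riesz)
      moreover have "measure riesz_measure (X - U) = 1 - measure riesz_measure (X \<inter> U)"
        using prob_compl[OF XU] by (simp add: space_riesz Diff_Int)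
      ultimately have "measure riesz_measure A \<le> measure riesz_measure (X - U) + e" by simp
      then have "emeasure riesz_measure A \<le> emeasure riesz_measure (X - U) + ennreal e"
        using e by (simp add: emeasure_eq_measure ennreal_plus[symmetric] del: ennreal_plus)
      also have "emeasure riesz_measure (X - U) \<le> (SUP K\<in>{K. compact K \<and> K \<subseteq> A}. emeasure riesz_measure K)"
        using K U(2) AX by (intro SUP_upper) auto
      finally show "emeasure riesz_measure A \<le> (SUP K\<in>{K. compact K \<and> K \<subseteq> A}. emeasure riesz_measure K) + ennreal e"
        by (simp add: add_right_mono)
    qed
  qed
qed (simp_all add: prob_space_riesz space_riesz sets_riesz)

section \<open>Integration against the Riesz measure\<close>

lemma integrable_riesz: "continuous_on X f \<Longrightarrow> integrable riesz_measure (f :: 'a \<Rightarrow> real)"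
  by (rule integrable_continuous_on_compact[OF prob_space.axioms(1)[OF prob_space_riesz]
        space_riesz sets_riesz compact_X])

text \<open>Slices \<open>f\<close> horizontally into \<open>n\<close> layers of height \<open>1 / n\<close>.\<close>

lemma L_le_integral_unit:
  assumes f: "continuous_on X f" "\<And>x. x \<in> X \<Longrightarrow> 0 \<le> f x \<and> f x \<le> 1" and n: "n > 0"
  shows "L f \<le> (\<integral>x. f x \<partial>riesz_measure) + 1 / real n"
proof -
  interpret prob_space riesz_measure by (rule prob_space_riesz)
  define slice where "slice i x = min (1 / n) (max 0 (f x - i / n))" for i :: nat and x
  define S where "S i = {x\<in>X. i / n < f x}" for i :: nat
  have slice_cont: "continuous_on X (slice i)" for i
    unfolding slice_def using f(1) by (intro continuous_intros)
  have S_sets: "S i \<in> sets riesz_measure" and L_slice: "real n * L (slice i) \<le> measure riesz_measure (S i)" for i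
  proof -
    obtain U where U: "open U" "U \<inter> X = f -` {i / n<..} \<inter> X"
      using f(1) unfolding continuous_on_open_invariant by (metis open_greaterThan)
    then have S: "S i = X \<inter> U" by (auto simp: S_def)
    then show "S i \<in> sets riesz_measure" using U(1) by (auto simp: sets_riesz sets_restrict_space)
    \<comment> \<open>Scaled to height 1, a layer is subordinate to the set where \<open>f\<close>
      exceeds \<open>i / n\<close>; this bounds \<open>L\<close> on it by the content, that is, by
      the measure of \<open>S i\<close>.\<close>
    have "(\<lambda>x. real n * slice i x) \<in> subordinate U"
      unfolding subordinate_def
    proof (intro CollectI conjI ballI impI)
      show "continuous_on X (\<lambda>x. real n * slice i x)" by (intro continuous_intros slice_cont)
      show "0 \<le> real n * slice i x" for x by (simp add: slice_def)
      have "real n * slice i x \<le> real n * (1 / n)" for x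
        by (intro mult_left_mono) (auto simp: slice_def)
      then show "real n * slice i x \<le> 1" for x using n by simp
      show "real n * slice i x = 0" if "x \<in> X" "x \<notin> U" for x
      proof -
        have "x \<notin> S i" using that S by blast
        then show ?thesis using that by (simp add: S_def slice_def max_def)
      qed
    qed
    then have "L (\<lambda>x. real n * slice i x) \<le> content U" by (rule L_le_content)
    then show "real n * L (slice i) \<le> measure riesz_measure (S i)"
      using emeasure_riesz_open[OF U(1)] L_scale[OF slice_cont]
      by (simp add: S measure_def content_nonneg)
  qed
  have sum_slice: "(\<Sum>i<k. slice i x) = min (k / n) (f x)" if "x \<in> X" for x k
  proof (induction k)
    case 0
    then show ?case using f(2)[OF that] by simp
  next
    case (Suc k)
    have "(\<Sum>i<Suc k. slice i x) = min (k / n) (f x) + slice k x" using Suc by simp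
    also have "\<dots> = min (k / n + 1 / n) (f x)"
    proof -
      have "min a y + min b (max 0 (y - a)) = min (a + b) y" if "b > 0" for a b y :: real
        using that by (simp add: min_def max_def)
      then show ?thesis using n by (simp add: slice_def)
    qed
    also have "k / n + 1 / n = real (Suc k) / n" by (simp add: add_divide_distrib)
    finally show ?case .
  qed
  have "L f = L (\<lambda>x. \<Sum>i<n. slice i x)"
    using f n by (intro L_cong continuous_intros slice_cont) (auto simp: sum_slice)
  also have "\<dots> = (\<Sum>i<n. L (slice i))" by (intro L_sum slice_cont) auto
  also have "\<dots> \<le> (\<Sum>i<n. measure riesz_measure (S i) / n)"
    using L_slice n by (intro sum_mono) (simp add: field_simps)
  also have "\<dots> = (\<integral>x. (\<Sum>i<n. indicator (S i) x) / n \<partial>riesz_measure)"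
    using S_sets by (simp add: sum_divide_distrib[symmetric] emeasure_eq_measure)
  also have "\<dots> \<le> (\<integral>x. f x + 1 / n \<partial>riesz_measure)"
  proof (rule integral_mono)
    show "integrable riesz_measure (\<lambda>x. (\<Sum>i<n. indicator (S i) x) / real n)"
      using S_sets by (intro integrable_divide integrable_sum) (simp add: emeasure_eq_measure)
    show "integrable riesz_measure (\<lambda>x. f x + 1 / n)"
      using integrable_riesz[OF f(1)] by simp
    fix x assume "x \<in> space riesz_measure"
    then have x: "x \<in> X" by (simp add: space_riesz)
    \<comment> \<open>An index counts when \<open>i < n * f x\<close>; as indices start at 0, there
      are at most \<open>n * f x + 1\<close> of them. The one extra layer is the error
      \<open>1 / n\<close>.\<close>
    have count: "(\<Sum>i<k. indicator (S i) x) \<le> min (real k) (n * f x + 1)" for k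
    proof (induction k)
      case 0
      then show ?case using f(2)[OF x] n by simp
    next
      case (Suc k)
      show ?case
      proof (cases "x \<in> S k")
        case True
        then have "real k \<le> n * f x" using n by (simp add: S_def field_simps)
        then show ?thesis using Suc True by simp
      qed (use Suc in simp)
    qed
    have "(\<Sum>i<n. indicator (S i) x) \<le> n * f x + 1" using count[of n] by simp
    then have "(\<Sum>i<n. indicator (S i) x) / n \<le> (n * f x + 1) / n"
      by (intro divide_right_mono) auto
    then show "(\<Sum>i<n. indicator (S i) x) / n \<le> f x + 1 / n" using n by (simp add: add_divide_distrib)
  qed
  also have "\<dots> = (\<integral>x. f x \<partial>riesz_measure) + 1 / n"
    using integrable_riesz[OF f(1)] by (simp add: prob_space[unfolded space_riesz] space_riesz)
  finally show ?thesis .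
qed

text \<open>The affine change \<open>g = (f + B) / (2 * B)\<close> leads into the unit interval, and
  the inequality survives it because both \<open>L\<close> and the integral fix constants.\<close>

lemma L_le_integral:
  assumes f: "continuous_on X f"
  shows "L f \<le> (\<integral>x. f x \<partial>riesz_measure)"
proof -
  interpret prob_space riesz_measure by (rule prob_space_riesz)
  have "bounded (f ` X)" using compact_continuous_image[OF f compact_X] compact_imp_bounded by blast
  then obtain b where "\<And>x. x \<in> X \<Longrightarrow> \<bar>f x\<bar> \<le> b" by (auto simp: bounded_iff)
  then obtain B where B: "B > 0" "\<And>x. x \<in> X \<Longrightarrow> \<bar>f x\<bar> \<le> B"
  proof -
    from \<open>\<And>x. x \<in> X \<Longrightarrow> \<bar>f x\<bar> \<le> b\<close> show thesis
      by (intro that[of "max 1 b"]) (auto simp: le_max_iff_disj)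
  qed
  define g where "g x = (1 / (2 * B)) * (f x + B)" for x
  have g: "continuous_on X g" "\<And>x. x \<in> X \<Longrightarrow> 0 \<le> g x \<and> g x \<le> 1"
  proof -
    show "continuous_on X g" unfolding g_def using f by (intro continuous_intros)
    show "0 \<le> g x \<and> g x \<le> 1" if "x \<in> X" for x
    proof
      have fx: "- B \<le> f x" "f x \<le> B" using B(2)[OF that] by linarith+
      then show "0 \<le> g x" using B(1) by (simp add: g_def)
      have "g x \<le> 1 / (2 * B) * (2 * B)"
        unfolding g_def using fx B(1) by (intro mult_left_mono) auto
      then show "g x \<le> 1" using B(1) by simp
    qed
  qed
  have "L g \<le> (\<integral>x. g x \<partial>riesz_measure) + e" if "e > 0" for e
  proof -
    from reals_Archimedean[OF that] obtain n where "inverse (real (Suc n)) < e" ..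
    then show ?thesis using L_le_integral_unit[OF g, of "Suc n"] by (simp add: inverse_eq_divide)
  qed
  then have le: "L g \<le> (\<integral>x. g x \<partial>riesz_measure)" by (rule field_le_epsilon)
  have "L g = (1 / (2 * B)) * L (\<lambda>x. f x + B)"
    unfolding g_def using f by (intro L_scale continuous_intros)
  also have "L (\<lambda>x. f x + B) = L f + B" using L_add[OF f, of "\<lambda>_. B"] by (simp add: L_const)
  finally have "L g = (L f + B) / (2 * B)" by simp
  moreover have "(\<integral>x. g x \<partial>riesz_measure) = ((\<integral>x. f x \<partial>riesz_measure) + B) / (2 * B)"
    using integrable_riesz[OF f] by (simp add: g_def prob_space[unfolded space_riesz] space_riesz)
  ultimately show ?thesis using le B(1) by (simp add: divide_le_cancel)
qed

lemma integral_riesz: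
  assumes f: "continuous_on X f"
  shows "(\<integral>x. f x \<partial>riesz_measure) = L f"
  using L_le_integral[OF f] L_le_integral[of "\<lambda>x. (- 1) * f x"] L_scale[OF f, of "- 1"] f
  by (simp add: continuous_on_minus)

end

section \<open>Measures determined by moments\<close>

lemma integrable_bounded_mult:
  fixes a f :: "'a \<Rightarrow> real"
  assumes "integrable M a" "f \<in> borel_measurable M" "\<And>x. x \<in> space M \<Longrightarrow> \<bar>f x\<bar> \<le> B"
  shows "integrable M (\<lambda>x. f x * a x)"
proof (rule Bochner_Integration.integrable_bound)
  show "integrable M (\<lambda>x. B * \<bar>a x\<bar>)" using assms(1) by simp
  show "(\<lambda>x. f x * a x) \<in> borel_measurable M" using assms(1,2) by simp
  show "AE x in M. norm (f x * a x) \<le> norm (B * \<bar>a x\<bar>)"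
  proof (rule AE_I2)
    fix x assume "x \<in> space M"
    then have "\<bar>f x\<bar> * \<bar>a x\<bar> \<le> B * \<bar>a x\<bar>" using assms(3) by (intro mult_right_mono) auto
    also have "\<dots> \<le> \<bar>B * \<bar>a x\<bar>\<bar>" by simp
    finally show "norm (f x * a x) \<le> norm (B * \<bar>a x\<bar>)" by (simp add: abs_mult)
  qed
qed

lemma integrable_continuous_comp_mult:
  fixes a u :: "'a \<Rightarrow> real" and f :: "real \<Rightarrow> real"
  assumes a: "integrable M a" and u: "u \<in> borel_measurable M" "\<And>x. x \<in> space M \<Longrightarrow> \<bar>u x\<bar> \<le> r"
    and f: "continuous_on UNIV f"
  shows "integrable M (\<lambda>x. f (u x) * a x)"
proof -
  have "bounded (f ` {-r..r})"
    using f by (intro compact_imp_bounded compact_continuous_image) (auto intro: continuous_on_subset)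
  then obtain B where B: "\<And>t. t \<in> {-r..r} \<Longrightarrow> \<bar>f t\<bar> \<le> B" by (force simp: bounded_iff)
  have "\<bar>f (u x)\<bar> \<le> B" if "x \<in> space M" for x
    using u(2)[OF that] by (intro B) (auto simp: abs_le_iff)
  moreover have "(\<lambda>x. f (u x)) \<in> borel_measurable M"
    using borel_measurable_continuous_onI[OF f] u(1) by simp
  ultimately show ?thesis by (intro integrable_bounded_mult[OF a])
qed

text \<open>The moments settle polynomials. Approximating \<open>f\<close> uniformly on
  \<open>[-r, r]\<close>, where \<open>u\<close> takes its values, costs at most a small multiple of
  \<open>c\<close>, the sum of the integrals of \<open>\<bar>a\<bar>\<close>.\<close>

lemma weighted_moments_continuous:
  fixes a u :: "'a \<Rightarrow> real" and f :: "real \<Rightarrow> real"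
  assumes a: "integrable M a" "integrable N a"
    and u: "u \<in> borel_measurable M" "u \<in> borel_measurable N"
    and r: "\<And>x. x \<in> space M \<union> space N \<Longrightarrow> \<bar>u x\<bar> \<le> r"
    and moments: "\<And>n. (\<integral>x. u x ^ n * a x \<partial>M) = (\<integral>x. u x ^ n * a x \<partial>N)"
    and f: "continuous_on UNIV f"
  shows "(\<integral>x. f (u x) * a x \<partial>M) = (\<integral>x. f (u x) * a x \<partial>N)"
proof -
  define c where "c = (\<integral>x. \<bar>a x\<bar> \<partial>M) + (\<integral>x. \<bar>a x\<bar> \<partial>N)"
  have c: "c \<ge> 0" by (simp add: c_def)
  have "\<bar>(\<integral>x. f (u x) * a x \<partial>M) - (\<integral>x. f (u x) * a x \<partial>N)\<bar> \<le> 0 + e" if e: "e > 0" for e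
  proof -
    \<comment> \<open>\<open>c + 1\<close> in place of \<open>c\<close>, as \<open>c\<close> may be
      0.\<close>
    define d where "d = e / (c + 1)"
    have d: "d > 0" using c e by (simp add: d_def)
    obtain g where g: "real_polynomial_function g" "\<And>t. t \<in> {-r..r} \<Longrightarrow> \<bar>f t - g t\<bar> < d"
      using Stone_Weierstrass_real_polynomial_function[of "{-r..r}" f d] f d
      by (auto intro: continuous_on_subset)
    have gc: "continuous_on UNIV g"
      using g(1) by (intro continuous_on_polymonial_function) (simp add: real_polynomial_function_eq)
    have close: "\<bar>(\<integral>x. f (u x) * a x \<partial>P) - (\<integral>x. g (u x) * a x \<partial>P)\<bar> \<le> d * (\<integral>x. \<bar>a x\<bar> \<partial>P)"
      if P: "integrable P a" "u \<in> borel_measurable P" "space P \<subseteq> space M \<union> space N" for P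
    proof -
      have ur: "\<bar>u x\<bar> \<le> r" if "x \<in> space P" for x using r that P(3) by blast
      note int = integrable_continuous_comp_mult[OF P(1,2) ur]
      have "(\<integral>x. f (u x) * a x \<partial>P) - (\<integral>x. g (u x) * a x \<partial>P) = (\<integral>x. f (u x) * a x - g (u x) * a x \<partial>P)"
        by (intro Bochner_Integration.integral_diff[symmetric] int f gc)
      also have "\<bar>\<dots>\<bar> \<le> (\<integral>x. \<bar>f (u x) * a x - g (u x) * a x\<bar> \<partial>P)"
        by (rule integral_abs_bound)
      also have "\<dots> \<le> (\<integral>x. d * \<bar>a x\<bar> \<partial>P)"
      proof (rule integral_mono)
        show "integrable P (\<lambda>x. \<bar>f (u x) * a x - g (u x) * a x\<bar>)"
          by (intro integrable_abs Bochner_Integration.integrable_diff int f gc)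
        show "integrable P (\<lambda>x. d * \<bar>a x\<bar>)" using P(1) by simp
        fix x assume "x \<in> space P"
        then have "\<bar>f (u x) - g (u x)\<bar> \<le> d"
          using ur[of x] by (intro less_imp_le g(2)) (auto simp: abs_le_iff)
        then have "\<bar>f (u x) - g (u x)\<bar> * \<bar>a x\<bar> \<le> d * \<bar>a x\<bar>" by (rule mult_right_mono) simp
        then show "\<bar>f (u x) * a x - g (u x) * a x\<bar> \<le> d * \<bar>a x\<bar>"
          by (simp add: abs_mult[symmetric] left_diff_distrib)
      qed
      finally show ?thesis by simp
    qed
    obtain k and n :: nat where k: "g = (\<lambda>x. \<Sum>i\<le>n. k i * x ^ i)"
      using g(1) by (auto simp: real_polynomial_function_iff_sum)
    have poly: "(\<integral>x. g (u x) * a x \<partial>P) = (\<Sum>i\<le>n. k i * (\<integral>x. u x ^ i * a x \<partial>P))"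
      if P: "integrable P a" "u \<in> borel_measurable P" "space P \<subseteq> space M \<union> space N" for P
    proof -
      have ur: "\<bar>u x\<bar> \<le> r" if "x \<in> space P" for x using r that P(3) by blast
      have int: "integrable P (\<lambda>x. u x ^ i * a x)" for i
        by (rule integrable_continuous_comp_mult[OF P(1,2) ur, where f = "\<lambda>t. t ^ i"])
          (auto intro!: continuous_intros)
      have "(\<integral>x. g (u x) * a x \<partial>P) = (\<integral>x. (\<Sum>i\<le>n. k i * (u x ^ i * a x)) \<partial>P)"
        by (simp add: k sum_distrib_right mult.assoc)
      also have "\<dots> = (\<Sum>i\<le>n. k i * (\<integral>x. u x ^ i * a x \<partial>P))"
        using int by simp
      finally show ?thesis .
    qed
    have "(\<integral>x. g (u x) * a x \<partial>M) = (\<integral>x. g (u x) * a x \<partial>N)"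
      using poly[OF a(1) u(1)] poly[OF a(2) u(2)] by (simp add: moments)
    then have "\<bar>(\<integral>x. f (u x) * a x \<partial>M) - (\<integral>x. f (u x) * a x \<partial>N)\<bar>
        \<le> d * (\<integral>x. \<bar>a x\<bar> \<partial>M) + d * (\<integral>x. \<bar>a x\<bar> \<partial>N)"
      using close[OF a(1) u(1)] close[OF a(2) u(2)] by auto
    also have "\<dots> = d * c" by (simp add: c_def distrib_left)
    also have "\<dots> \<le> d * (c + 1)" using d by simp
    also have "\<dots> = e" using c by (simp add: d_def)
    finally show ?thesis by simp
  qed
  then have "\<bar>(\<integral>x. f (u x) * a x \<partial>M) - (\<integral>x. f (u x) * a x \<partial>N)\<bar> \<le> 0"
    by (rule field_le_epsilon)
  then show ?thesis by simp
qed

lemma weighted_moments_atMost: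
  fixes a u :: "'a \<Rightarrow> real"
  assumes a: "integrable M a" "integrable N a"
    and u: "u \<in> borel_measurable M" "u \<in> borel_measurable N"
    and r: "\<And>x. x \<in> space M \<union> space N \<Longrightarrow> \<bar>u x\<bar> \<le> r"
    and moments: "\<And>n. (\<integral>x. u x ^ n * a x \<partial>M) = (\<integral>x. u x ^ n * a x \<partial>N)"
  shows "(\<integral>x. indicator {..c} (u x) * a x \<partial>M) = (\<integral>x. indicator {..c} (u x) * a x \<partial>N)"
proof -
  \<comment> \<open>A continuous ramp: 1 up to \<open>c\<close>, then falling to 0 at
    \<open>c + 1 / k\<close> for \<open>k > 0\<close>. The ramps converge to the indicator of
    \<open>{..c}\<close> at every point, also at \<open>c\<close> itself.\<close>
  define f where "f k t = max 0 (min 1 (1 - real k * (t - c)))" for k t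
  have fc: "continuous_on UNIV (f k)" for k unfolding f_def by (intro continuous_intros)
  have f_bound: "\<bar>f k t\<bar> \<le> 1" for k t by (simp add: f_def)
  have f_lim: "(\<lambda>k. f k t) \<longlonglongrightarrow> indicator {..c} t" for t
  proof (cases "t \<le> c")
    case True
    then have "f k t = 1" for k by (simp add: f_def mult_nonneg_nonpos max_def min_def)
    then show ?thesis using True by simp
  next
    case False
    obtain m where m: "1 / (t - c) < real m" using reals_Archimedean2 by blast
    have "f k t = 0" if "m \<le> k" for k
    proof -
      have "1 / (t - c) < real k" using m that by simp
      then have "1 < real k * (t - c)" using False by (simp add: field_simps)
      then show ?thesis by (simp add: f_def)
    qed
    then have "eventually (\<lambda>k. f k t = 0) sequentially" by (auto simp: eventually_sequentially)
    then show ?thesis using False by (simp add: tendsto_eventually)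
  qed
  have lim: "(\<lambda>k. \<integral>x. f k (u x) * a x \<partial>P) \<longlonglongrightarrow> (\<integral>x. indicator {..c} (u x) * a x \<partial>P)"
    if P: "integrable P a" "u \<in> borel_measurable P" for P
  proof (rule integral_dominated_convergence[where w = "\<lambda>x. \<bar>a x\<bar>"])
    note [measurable] = P(2) borel_measurable_integrable[OF P(1)]
    show "(\<lambda>x. indicator {..c} (u x) * a x) \<in> borel_measurable P" by measurable
    have "(\<lambda>x. f k (u x)) \<in> borel_measurable P" for k
      using borel_measurable_continuous_onI[OF fc] by measurable
    then show "(\<lambda>x. f k (u x) * a x) \<in> borel_measurable P" for k by measurable
    show "integrable P (\<lambda>x. \<bar>a x\<bar>)" using P(1) by simp
    show "AE x in P. (\<lambda>k. f k (u x) * a x) \<longlonglongrightarrow> indicator {..c} (u x) * a x"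
      by (intro AE_I2 tendsto_mult_right f_lim)
    show "AE x in P. norm (f k (u x) * a x) \<le> \<bar>a x\<bar>" for k
      using f_bound by (intro AE_I2) (simp add: abs_mult mult_left_le_one_le)
  qed
  have "(\<integral>x. f k (u x) * a x \<partial>M) = (\<integral>x. f k (u x) * a x \<partial>N)" for k
    by (rule weighted_moments_continuous[OF a u r moments fc])
  then show ?thesis using lim[OF a(1) u(1)] lim[OF a(2) u(2)] LIMSEQ_unique by simp
qed

text \<open>\<open>ennreal\<close> cuts negative values off at 0, so the density is \<open>a\<close>
  only where \<open>a \<ge> 0\<close>; hence the sign conditions on \<open>a\<close> in what
  follows. The gain is that finite positive measures are determined by half-lines.\<close>

definition weighted_distr :: "'a measure \<Rightarrow> ('a \<Rightarrow> real) \<Rightarrow> ('a \<Rightarrow> real) \<Rightarrow> real measure" where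
  "weighted_distr M a u = distr (density M (\<lambda>x. ennreal (a x))) borel u"

lemma integral_weighted_distr:
  fixes f :: "real \<Rightarrow> real"
  assumes "integrable M a" "u \<in> borel_measurable M" "\<And>x. x \<in> space M \<Longrightarrow> 0 \<le> a x"
    "f \<in> borel_measurable borel"
  shows "(\<integral>t. f t \<partial>weighted_distr M a u) = (\<integral>x. f (u x) * a x \<partial>M)"
  using assms unfolding weighted_distr_def
  by (subst integral_distr) (auto simp: integral_density mult.commute)

lemma finite_measure_weighted_distr:
  assumes "integrable M a" "u \<in> borel_measurable M" "\<And>x. x \<in> space M \<Longrightarrow> 0 \<le> a x"
  shows "finite_measure (weighted_distr M a u)"
proof (rule finite_measureI)
  have "emeasure (density M (\<lambda>x. ennreal (a x))) (space M) = (\<integral>\<^sup>+x. ennreal (a x) \<partial>M)"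
    using assms(1) by (subst emeasure_density) (auto intro!: nn_integral_cong)
  also have "\<dots> = ennreal (\<integral>x. a x \<partial>M)"
    using assms by (intro nn_integral_eq_integral) auto
  finally show "emeasure (weighted_distr M a u) (space (weighted_distr M a u)) \<noteq> \<infinity>"
    using assms(2) by (simp add: weighted_distr_def emeasure_distr)
qed

lemma measure_weighted_distr:
  assumes "integrable M a" "u \<in> borel_measurable M" "\<And>x. x \<in> space M \<Longrightarrow> 0 \<le> a x"
    "B \<in> sets borel"
  shows "measure (weighted_distr M a u) B = (\<integral>x. indicator B (u x) * a x \<partial>M)"
proof -
  have "measure (weighted_distr M a u) B = (\<integral>t. indicator B t \<partial>weighted_distr M a u)"
    using assms(4) by (simp add: weighted_distr_def)
  also have "\<dots> = (\<integral>x. indicator B (u x) * a x \<partial>M)"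
    using assms by (intro integral_weighted_distr) auto
  finally show ?thesis .
qed

lemma weighted_distr_eqI:
  assumes a: "integrable M a" "integrable N a"
    and u: "u \<in> borel_measurable M" "u \<in> borel_measurable N"
    and nonneg: "\<And>x. x \<in> space M \<union> space N \<Longrightarrow> 0 \<le> a x"
    and eq: "\<And>c. (\<integral>x. indicator {..c} (u x) * a x \<partial>M) = (\<integral>x. indicator {..c} (u x) * a x \<partial>N)"
  shows "weighted_distr M a u = weighted_distr N a u"
proof -
  interpret M: finite_measure "weighted_distr M a u"
    using a u nonneg by (intro finite_measure_weighted_distr) auto
  interpret N: finite_measure "weighted_distr N a u"
    using a u nonneg by (intro finite_measure_weighted_distr) auto
  have sets: "sets (borel :: real measure) = sigma_sets UNIV (range atMost)"
    by (subst borel_eq_atMost) simp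
  show ?thesis
  proof (rule measure_eqI_generator_eq[where E = "range atMost" and \<Omega> = UNIV and A = "\<lambda>i. {..real i}"])
    show "Int_stable (range (atMost :: real \<Rightarrow> _))" by (auto simp: Int_stable_def)
    show "emeasure (weighted_distr M a u) {..real i} \<noteq> \<infinity>" for i
      using M.emeasure_finite by simp
    show "(\<Union>i. {..real i}) = UNIV" using real_arch_simple by auto
    show "emeasure (weighted_distr M a u) A = emeasure (weighted_distr N a u) A"
      if A: "A \<in> range atMost" for A
    proof -
      obtain c where c: "A = {..c}" using A by auto
      have "measure (weighted_distr M a u) A = measure (weighted_distr N a u) A"
        using measure_weighted_distr[OF a(1) u(1), of A] measure_weighted_distr[OF a(2) u(2), of A]
          nonneg eq by (simp add: c)
      then show ?thesis by (simp add: M.emeasure_eq_measure N.emeasure_eq_measure)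
    qed
  qed (auto simp: weighted_distr_def sets)
qed

section \<open>Upper envelopes\<close>

definition upper_envelope :: "'a::locally_convex_space set \<Rightarrow> ('a \<Rightarrow> real) \<Rightarrow> 'a \<Rightarrow> real" where
  "upper_envelope X g x = (INF h\<in>{h \<in> A_c X. \<forall>y\<in>ext X. g y \<le> h y}. h x)"

lemma ext_subset: "ext X \<subseteq> X"
  by (auto simp: ext_def extreme_point_of_def)

context
  fixes X :: "'a::locally_convex_space set"
  assumes X: "compact X"
begin

lemma continuous_on_bound:
  fixes f :: "'a \<Rightarrow> real"
  assumes "continuous_on X f"
  obtains B where "\<And>x. x \<in> X \<Longrightarrow> \<bar>f x\<bar> \<le> B"
proof -
  have "bounded (f ` X)" using compact_continuous_image[OF assms X] compact_imp_bounded by blast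
  then show thesis using that by (auto simp: bounded_iff)
qed

lemma majorants_nonempty:
  assumes "continuous_on X g"
  shows "{h \<in> A_c X. \<forall>y\<in>ext X. g y \<le> h y} \<noteq> {}"
proof -
  obtain B where "\<And>x. x \<in> X \<Longrightarrow> \<bar>g x\<bar> \<le> B" using continuous_on_bound[OF assms] by blast
  then have "(\<lambda>_. B) \<in> {h \<in> A_c X. \<forall>y\<in>ext X. g y \<le> h y}"
    using ext_subset[of X] by (auto simp: A_c_const abs_le_iff)
  then show ?thesis by blast
qed

text \<open>A real infimum lies below its members only if these are bounded below; the minimum
  principle carries the bound \<open>- B\<close> for majorants from \<open>ext X\<close> to
  \<open>x\<close>.\<close>

lemma upper_envelope_le:
  assumes g: "continuous_on X g" and x: "x \<in> X" and h: "h \<in> A_c X" "\<And>y. y \<in> ext X \<Longrightarrow> g y \<le> h y"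
  shows "upper_envelope X g x \<le> h x"
proof -
  obtain B where B: "\<And>x. x \<in> X \<Longrightarrow> \<bar>g x\<bar> \<le> B" using continuous_on_bound[OF g] by blast
  have "- B \<le> h' x" if h': "h' \<in> A_c X" "\<forall>y\<in>ext X. g y \<le> h' y" for h'
  proof (rule A_c_minimum_principle[OF X h'(1) _ x])
    fix y assume y: "y \<in> ext X"
    then have "\<bar>g y\<bar> \<le> B" "g y \<le> h' y" using B ext_subset h'(2) by blast+
    then show "- B \<le> h' y" by linarith
  qed
  then have "bdd_below ((\<lambda>h. h x) ` {h \<in> A_c X. \<forall>y\<in>ext X. g y \<le> h y})"
    by (intro bdd_belowI2[of _ "- B"]) auto
  then show ?thesis unfolding upper_envelope_def using h by (intro cINF_lower) auto
qed

lemma upper_envelope_ge: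
  assumes g: "continuous_on X g"
    and c: "\<And>h. h \<in> A_c X \<Longrightarrow> (\<And>y. y \<in> ext X \<Longrightarrow> g y \<le> h y) \<Longrightarrow> c \<le> h x"
  shows "c \<le> upper_envelope X g x"
  unfolding upper_envelope_def using c by (intro cINF_greatest majorants_nonempty g) auto

lemma upper_envelope_less:
  assumes g: "continuous_on X g" and less: "upper_envelope X g x < c"
  obtains h where "h \<in> A_c X" "\<And>y. y \<in> ext X \<Longrightarrow> g y \<le> h y" "h x < c"
proof -
  have "\<exists>h\<in>A_c X. (\<forall>y\<in>ext X. g y \<le> h y) \<and> h x < c"
  proof (rule ccontr)
    assume "\<not> ?thesis"
    then have "c \<le> upper_envelope X g x" by (intro upper_envelope_ge[OF g]) (auto simp: not_less)
    then show False using less by simp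
  qed
  then show thesis using that by blast
qed

lemma upper_envelope_concave:
  assumes g: "continuous_on X g" and xy: "x \<in> X" "y \<in> X" and t: "0 \<le> t" "t \<le> 1"
  shows "(1 - t) * upper_envelope X g x + t * upper_envelope X g y
    \<le> upper_envelope X g ((1 - t) *\<^sub>R x + t *\<^sub>R y)"
proof (rule upper_envelope_ge[OF g])
  fix h assume h: "h \<in> A_c X" "\<And>y. y \<in> ext X \<Longrightarrow> g y \<le> h y"
  have "(1 - t) * upper_envelope X g x + t * upper_envelope X g y \<le> (1 - t) * h x + t * h y"
    using upper_envelope_le[OF g xy(1) h] upper_envelope_le[OF g xy(2) h] t
    by (intro add_mono mult_left_mono) auto
  then show "(1 - t) * upper_envelope X g x + t * upper_envelope X g y \<le> h ((1 - t) *\<^sub>R x + t *\<^sub>R y)"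
    using A_c_affine[OF h(1) xy t] by simp
qed

lemma upper_envelope_usc:
  assumes g: "continuous_on X g" and x: "x \<in> X" and less: "upper_envelope X g x < c"
  shows "eventually (\<lambda>y. upper_envelope X g y < c) (at x within X)"
proof -
  obtain h where h: "h \<in> A_c X" "\<And>y. y \<in> ext X \<Longrightarrow> g y \<le> h y" "h x < c"
    using upper_envelope_less[OF g less] by blast
  have "(h \<longlongrightarrow> h x) (at x within X)" using A_c_continuous[OF h(1)] x by (auto simp: continuous_on_def)
  then have "eventually (\<lambda>y. h y < c) (at x within X)" using h(3) by (rule order_tendstoD)
  moreover have "eventually (\<lambda>y. y \<in> X) (at x within X)" by (simp add: eventually_at_topological) blast
  ultimately show ?thesis
    by eventually_elim (use upper_envelope_le[OF g _ h(1,2)] in \<open>auto intro: order.strict_trans1\<close>)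
qed

text \<open>The envelope is sublinear in \<open>g\<close>; a linear functional that it dominates and that agrees
  with it at \<open>g\<close> is integration against a representing measure.\<close>

lemma upper_envelope_attained:
  assumes g: "continuous_on X g" and x: "x \<in> X"
  obtains M where "M \<in> M_1 X (closure (ext X))" "represents X M x"
    "(\<integral>y. g y \<partial>M) = upper_envelope X g x"
proof -
  define V where "V = {f :: 'a \<Rightarrow> real. continuous_on X f}"
  define p where "p f = upper_envelope X f x" for f
  have V: "subspace V"
    unfolding subspace_def V_def func_plus scaleR_fun_def func_zero by (auto intro!: continuous_intros)
  have "sublinear_on V p"
  proof (rule sublinear_onI[OF V])
    fix f f' assume "f \<in> V" "f' \<in> V"
    then have f: "continuous_on X f" "continuous_on X f'" by (simp_all add: V_def)
    have ff: "continuous_on X (f + f')" unfolding func_plus by (intro continuous_intros f)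
    have *: "p (f + f') \<le> h x + h' x"
      if "h \<in> A_c X" "\<And>y. y \<in> ext X \<Longrightarrow> f y \<le> h y" "h' \<in> A_c X" "\<And>y. y \<in> ext X \<Longrightarrow> f' y \<le> h' y" for h h'
      unfolding p_def using upper_envelope_le[OF ff x A_c_add[OF that(1,3)]] that(2,4)
      by (simp add: add_mono)
    have "p (f + f') - h' x \<le> p f" if "h' \<in> A_c X" "\<And>y. y \<in> ext X \<Longrightarrow> f' y \<le> h' y" for h'
      unfolding p_def[of f] using *[OF _ _ that]
      by (intro upper_envelope_ge[OF f(1)]) (simp add: algebra_simps)
    then have "p (f + f') - p f \<le> p f'"
      unfolding p_def[of f'] by (intro upper_envelope_ge[OF f(2)]) (simp add: algebra_simps)
    then show "p (f + f') \<le> p f + p f'" by simp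
  next
    show "p 0 = 0"
    proof (rule antisym)
      show "p 0 \<le> 0"
        unfolding p_def func_zero by (rule upper_envelope_le[OF _ x]) (auto simp: A_c_const)
      show "0 \<le> p 0"
        unfolding p_def func_zero
        by (rule upper_envelope_ge) (auto intro: A_c_minimum_principle[OF X _ _ x])
    qed
  next
    fix f :: "'a \<Rightarrow> real" and c :: real assume "f \<in> V" and c: "c > 0"
    then have f: "continuous_on X f" by (simp add: V_def)
    have cf: "continuous_on X (c *\<^sub>R f)" unfolding scaleR_fun_def by (intro continuous_intros f)
    have "p (c *\<^sub>R f) / c \<le> p f"
      unfolding p_def[of f]
    proof (rule upper_envelope_ge[OF f])
      fix h assume h: "h \<in> A_c X" "\<And>y. y \<in> ext X \<Longrightarrow> f y \<le> h y"
      have "p (c *\<^sub>R f) \<le> c * h x"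
        unfolding p_def using c h(2)
        by (intro upper_envelope_le[OF cf x A_c_scale[OF h(1)]]) (simp add: scaleR_fun_def)
      then show "p (c *\<^sub>R f) / c \<le> h x" using c by (simp add: field_simps)
    qed
    then show "p (c *\<^sub>R f) \<le> c * p f" using c by (simp add: field_simps)
  qed
  moreover have "g \<in> V" using g by (simp add: V_def)
  ultimately obtain L where L: "\<And>f f'. f \<in> V \<Longrightarrow> f' \<in> V \<Longrightarrow> L (f + f') = L f + L f'"
      "\<And>f c. f \<in> V \<Longrightarrow> L (c *\<^sub>R f) = c * L f" "\<And>f. f \<in> V \<Longrightarrow> L f \<le> p f" and Lg: "L g = p g"
    using Hahn_Banach_attained[OF V, of p g] by blast
  have L_add: "L (\<lambda>y. f y + f' y) = L f + L f'" if "continuous_on X f" "continuous_on X f'" for f f'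
    using L(1)[of f f'] that by (simp add: V_def func_plus)
  have L_scale: "L (\<lambda>y. c * f y) = c * L f" if "continuous_on X f" for f c
    using L(2)[of f c] that by (simp add: V_def scaleR_fun_def)
  have L_le: "L f \<le> h x" if "continuous_on X f" "h \<in> A_c X" "\<And>y. y \<in> ext X \<Longrightarrow> f y \<le> h y" for f h
    using L(3)[of f] upper_envelope_le[OF that(1) x that(2,3)] that(1) by (simp add: V_def p_def)
  \<comment> \<open>Both \<open>h\<close> and \<open>- h\<close> are their own majorants, so
    domination by the envelope pins \<open>L h\<close> from both sides.\<close>
  have L_A_c: "L h = h x" if h: "h \<in> A_c X" for h
  proof (rule antisym)
    show "L h \<le> h x" by (rule L_le[OF A_c_continuous[OF h] h]) simp
    note h' = A_c_scale[OF h, of "- 1"]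
    have "L (\<lambda>y. - 1 * h y) \<le> - 1 * h x" by (rule L_le[OF A_c_continuous[OF h'] h']) simp
    then show "h x \<le> L h" using L_scale[OF A_c_continuous[OF h], of "- 1"] by simp
  qed
  have L_nonpos: "L f \<le> 0" if "continuous_on X f" "\<And>y. y \<in> ext X \<Longrightarrow> f y \<le> 0" for f
    using L_le[OF that(1) A_c_const[of 0]] that(2) by simp
  interpret state X L
  proof
    show "compact X" by (rule X)
    show "0 \<le> L f" if f: "continuous_on X f" and "\<And>y. y \<in> X \<Longrightarrow> 0 \<le> f y" for f
    proof -
      have "L (\<lambda>y. - 1 * f y) \<le> 0"
        using that ext_subset[of X] by (intro L_nonpos continuous_intros) auto
      then show ?thesis using L_scale[OF f, of "- 1"] by simp
    qed
    show "L (\<lambda>_. 1) = 1" using L_A_c[OF A_c_const] .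
  qed (simp_all add: L_add L_scale)
  \<comment> \<open>A Urysohn function that is 1 on \<open>K\<close> and 0 on the closure of
    \<open>ext X\<close> has \<open>L f \<le> 0\<close> and dominates the indicator of
    \<open>K\<close>. Inner regularity then passes from compact sets to the whole complement of the
    closure.\<close>
  have "emeasure riesz_measure K = 0" if K: "compact K" "K \<subseteq> X - closure (ext X)" for K
  proof -
    interpret prob_space riesz_measure by (rule prob_space_riesz)
    obtain f where f: "continuous_on X f" "\<And>x. x \<in> X \<Longrightarrow> 0 \<le> f x \<and> f x \<le> 1"
      "\<And>x. x \<in> X \<Longrightarrow> x \<in> closure (ext X) \<Longrightarrow> f x = 0" "\<And>x. x \<in> X \<Longrightarrow> x \<in> K \<Longrightarrow> f x = (1::real)"
      using Urysohn_compact[OF X closed_closure[of "ext X"] compact_imp_closed[OF K(1)]] K(2) by blast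
    have Ks: "K \<in> sets riesz_measure"
      using K compact_imp_closed[OF K(1)] by (auto simp: sets_riesz sets_restrict_space intro!: image_eqI[of _ _ K])
    have "measure riesz_measure K = (\<integral>x. indicator K x \<partial>riesz_measure)" using Ks by simp
    also have "\<dots> \<le> (\<integral>x. f x \<partial>riesz_measure)"
      using Ks f K(2) integrable_riesz[OF f(1)]
      by (intro integral_mono) (auto simp: space_riesz emeasure_eq_measure split: split_indicator)
    also have "\<dots> = L f" by (rule integral_riesz[OF f(1)])
    also have "\<dots> \<le> 0"
      using f(3) ext_subset closure_subset by (intro L_nonpos f(1)) (force intro: eq_refl)
    finally show ?thesis by (simp add: emeasure_eq_measure measure_le_0_iff)
  qed
  moreover have "X - closure (ext X) \<in> sets riesz_measure"
    by (auto simp: sets_riesz sets_restrict_space intro!: image_eqI[of _ _ "- closure (ext X)"])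
  ultimately have "emeasure riesz_measure (X - closure (ext X)) = 0"
    using radon_prob_riesz unfolding radon_prob_def by (auto intro!: SUP_eq_const)
  then have "riesz_measure \<in> M_1 X (closure (ext X))" by (simp add: M_1_def radon_prob_riesz)
  moreover have "represents X riesz_measure x"
    using x by (simp add: represents_def integral_riesz A_c_continuous L_A_c)
  moreover have "(\<integral>y. g y \<partial>riesz_measure) = upper_envelope X g x"
    using integral_riesz[OF g] Lg by (simp add: p_def)
  ultimately show thesis by (rule that)
qed

end

section \<open>Multipliers\<close>

lemma M_1D:
  assumes "M \<in> M_1 X F"
  shows "prob_space M" "space M = X" "sets M = sets (restrict_space borel X)"
    "emeasure M (X - F) = 0"
  using assms by (auto simp: M_1_def radon_prob_def)

lemma M_1_integrable:
  fixes f :: "'a::topological_space \<Rightarrow> real"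
  assumes "M \<in> M_1 X F" "compact X" "continuous_on X f"
  shows "integrable M f"
  using M_1D[OF assms(1)] assms(2,3)
  by (intro integrable_continuous_on_compact) (auto simp: prob_space_def)

lemma M_1_measurable:
  fixes f :: "'a::topological_space \<Rightarrow> real"
  assumes "M \<in> M_1 X F" "continuous_on X f"
  shows "f \<in> borel_measurable M"
  using M_1D(3)[OF assms(1)] assms(2) by (rule continuous_on_borel_measurable)

text \<open>The set where \<open>f\<close> and \<open>g\<close> agree is closed and contains
  \<open>ext X\<close>, hence also its closure, which carries \<open>M\<close>.\<close>

lemma AE_eq_of_eq_on_ext:
  fixes X :: "'a::locally_convex_space set" and f g :: "'a \<Rightarrow> real"
  assumes X: "compact X" and M: "M \<in> M_1 X (closure (ext X))"
    and f: "continuous_on X f" and g: "continuous_on X g" and eq: "\<And>x. x \<in> ext X \<Longrightarrow> f x = g x"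
  shows "AE x in M. f x = g x"
proof (rule AE_I)
  have "closed {x\<in>X. f x - g x = 0}"
    using X f g by (intro continuous_closed_preimage_constant continuous_on_diff compact_imp_closed)
  moreover have "ext X \<subseteq> {x\<in>X. f x - g x = 0}" using eq ext_subset by auto
  ultimately have "closure (ext X) \<subseteq> {x\<in>X. f x - g x = 0}" by (rule closure_minimal[rotated])
  then show "{x \<in> space M. \<not> f x = g x} \<subseteq> X - closure (ext X)" by (auto simp: M_1D(2)[OF M])
  show "emeasure M (X - closure (ext X)) = 0" by (rule M_1D(4)[OF M])
  show "X - closure (ext X) \<in> sets M"
    by (auto simp: M_1D(3)[OF M] sets_restrict_space intro!: image_eqI[of _ _ "- closure (ext X)"])
qed

lemma integral_uniform_measure_eq:
  fixes a :: "'a \<Rightarrow> real"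
  assumes M: "finite_measure M" and S: "S \<in> sets M" "measure M S > 0" and a: "a \<in> borel_measurable M"
  shows "(\<integral>x. a x \<partial>uniform_measure M S) = (\<integral>x. indicator S x * a x \<partial>M) / measure M S"
proof -
  interpret finite_measure M by fact
  have "uniform_measure M S = density M (\<lambda>x. ennreal (indicator S x / measure M S))"
    unfolding uniform_measure_def emeasure_eq_measure
    using S(2) by (intro arg_cong2[where f = density] ext) (simp_all add: divide_ennreal ennreal_indicator[symmetric])
  then have "(\<integral>x. a x \<partial>uniform_measure M S) = (\<integral>x. (indicator S x / measure M S) *\<^sub>R a x \<partial>M)"
    using S a by (simp add: integral_density)
  also have "\<dots> = (\<integral>x. (indicator S x * a x) / measure M S \<partial>M)" by simp
  also have "\<dots> = (\<integral>x. indicator S x * a x \<partial>M) / measure M S" by (rule integral_divide_zero)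
  finally show ?thesis .
qed

text \<open>\<open>a + \<bar>K\<bar>\<close> and the constant \<open>\<bar>K\<bar>\<close> are
  nonnegative on \<open>X\<close>, lie in \<open>A_c X\<close> and differ by \<open>a\<close>. The
  weights \<open>w\<close> of interest are \<open>u\<close> and the indicator of a Borel set
  composed with \<open>u\<close>.\<close>

lemma A_c_integrals_eq_of_nonneg:
  fixes X :: "'a::locally_convex_space set" and w a :: "'a \<Rightarrow> real"
  assumes X: "compact X" and M: "M \<in> M_1 X F" and N: "N \<in> M_1 X F"
    and w: "w \<in> borel_measurable M" "w \<in> borel_measurable N" "\<And>x. x \<in> X \<Longrightarrow> \<bar>w x\<bar> \<le> B"
    and nonneg: "\<And>a. a \<in> A_c X \<Longrightarrow> (\<And>x. x \<in> X \<Longrightarrow> 0 \<le> a x) \<Longrightarrow>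
      (\<integral>x. w x * a x \<partial>M) = (\<integral>x. w x * a x \<partial>N)"
    and a: "a \<in> A_c X"
  shows "(\<integral>x. w x * a x \<partial>M) = (\<integral>x. w x * a x \<partial>N)"
proof -
  obtain K where K: "\<And>x. x \<in> X \<Longrightarrow> \<bar>a x\<bar> \<le> K"
    using continuous_on_bound[OF X A_c_continuous[OF a]] by blast
  have int: "integrable P (\<lambda>x. w x * b x)"
    if "P \<in> M_1 X F" "w \<in> borel_measurable P" "b \<in> A_c X" for P b
    using M_1_integrable[OF that(1) X A_c_continuous[OF that(3)]] that(2) w(3) M_1D(2)[OF that(1)]
    by (intro integrable_bounded_mult) auto
  have split: "(\<integral>x. w x * a x \<partial>P) = (\<integral>x. w x * (a x + \<bar>K\<bar>) \<partial>P) - (\<integral>x. w x * \<bar>K\<bar> \<partial>P)"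
    if P: "P \<in> M_1 X F" "w \<in> borel_measurable P" for P
    using Bochner_Integration.integral_add[OF int[OF P a] int[OF P A_c_const[of "\<bar>K\<bar>"]]]
    by (simp add: distrib_left)
  have "(\<integral>x. w x * (a x + \<bar>K\<bar>) \<partial>M) = (\<integral>x. w x * (a x + \<bar>K\<bar>) \<partial>N)"
    using K by (intro nonneg A_c_add a A_c_const) force
  moreover have "(\<integral>x. w x * \<bar>K\<bar> \<partial>M) = (\<integral>x. w x * \<bar>K\<bar> \<partial>N)"
    by (intro nonneg A_c_const) auto
  ultimately show ?thesis using split[OF M w(1)] split[OF N w(2)] by simp
qed

lemma multiplier_moments:
  fixes X :: "'a::locally_convex_space set"
  assumes X: "compact X" and u: "multiplier X u"
    and M: "M \<in> M_1 X (closure (ext X))" "represents X M x"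
    and N: "N \<in> M_1 X (closure (ext X))" "represents X N x"
    and a: "a \<in> A_c X"
  shows "(\<integral>y. u y ^ n * a y \<partial>M) = (\<integral>y. u y ^ n * a y \<partial>N)"
  using a
proof (induction n arbitrary: a)
  case 0
  then show ?case using M(2) N(2) by (simp add: represents_def)
next
  case (Suc n)
  have uc: "continuous_on X u" using u by (simp add: multiplier_def A_c_continuous)
  \<comment> \<open>Almost everywhere \<open>b\<close> absorbs one factor \<open>u\<close>; the
    induction hypothesis, stated for all affine functions, then applies to \<open>b\<close>.\<close>
  obtain b where b: "b \<in> A_c X" "\<And>x. x \<in> ext X \<Longrightarrow> b x = u x * a x"
    using u Suc.prems by (auto simp: multiplier_def)
  have "(\<integral>y. u y ^ Suc n * a y \<partial>P) = (\<integral>y. u y ^ n * b y \<partial>P)"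
    if P: "P \<in> M_1 X (closure (ext X))" for P
  proof (rule integral_cong_AE)
    note cont = uc A_c_continuous[OF Suc.prems] A_c_continuous[OF b(1)]
    show "(\<lambda>y. u y ^ Suc n * a y) \<in> borel_measurable P" "(\<lambda>y. u y ^ n * b y) \<in> borel_measurable P"
      by (intro M_1_measurable[OF P] continuous_intros cont)+
    have "AE y in P. b y = u y * a y"
      by (intro AE_eq_of_eq_on_ext[OF X P] continuous_intros cont b(2))
    then show "AE y in P. u y ^ Suc n * a y = u y ^ n * b y" by eventually_elim simp
  qed
  then show ?case using Suc.IH[OF b(1)] M(1) N(1) by simp
qed

text \<open>The moments give half-lines; for \<open>a \<ge> 0\<close> these determine the image
  measures, and with them the values at all Borel sets.\<close>

lemma multiplier_indicator_integrals:
  fixes X :: "'a::locally_convex_space set"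
  assumes X: "compact X" and u: "multiplier X u"
    and M: "M \<in> M_1 X (closure (ext X))" "represents X M x"
    and N: "N \<in> M_1 X (closure (ext X))" "represents X N x"
    and a: "a \<in> A_c X" and B: "B \<in> sets borel"
  shows "(\<integral>y. indicator B (u y) * a y \<partial>M) = (\<integral>y. indicator B (u y) * a y \<partial>N)"
proof -
  have uc: "continuous_on X u" using u by (simp add: multiplier_def A_c_continuous)
  note um = M_1_measurable[OF M(1) uc] M_1_measurable[OF N(1) uc]
  note space = M_1D(2)[OF M(1)] M_1D(2)[OF N(1)]
  obtain r where r: "\<And>x. x \<in> X \<Longrightarrow> \<bar>u x\<bar> \<le> r" using continuous_on_bound[OF X uc] by blast
  show ?thesis
  proof (rule A_c_integrals_eq_of_nonneg[OF X M(1) N(1) _ _ _ _ a, where B = 1])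
    show "(\<lambda>y. indicator B (u y)) \<in> borel_measurable M" "(\<lambda>y. indicator B (u y)) \<in> borel_measurable N"
      using um B by auto
    fix a assume a: "a \<in> A_c X" and nonneg: "\<And>x. x \<in> X \<Longrightarrow> 0 \<le> a x"
    note int = M_1_integrable[OF M(1) X A_c_continuous[OF a]] M_1_integrable[OF N(1) X A_c_continuous[OF a]]
    have "weighted_distr M a u = weighted_distr N a u"
    proof (rule weighted_distr_eqI[OF int um])
      show "(\<integral>y. indicator {..c} (u y) * a y \<partial>M) = (\<integral>y. indicator {..c} (u y) * a y \<partial>N)" for c
        by (rule weighted_moments_atMost[OF int um _ multiplier_moments[OF X u M N a], of r])
          (use r space in auto)
    qed (use nonneg space in auto)
    then show "(\<integral>y. indicator B (u y) * a y \<partial>M) = (\<integral>y. indicator B (u y) * a y \<partial>N)"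
      using measure_weighted_distr[OF int(1) um(1) _ B] measure_weighted_distr[OF int(2) um(2) _ B]
        nonneg space by simp
  qed (auto split: split_indicator)
qed

text \<open>For \<open>a \<ge> 0\<close> the hypothesis identifies the images under \<open>u\<close>
  of the weighted measures, and the claim is the equality of their first moments.\<close>

lemma integral_mult_eq_of_indicator:
  fixes X :: "'a::locally_convex_space set"
  assumes X: "compact X" and u: "u \<in> A_c X" and M: "M \<in> M_1 X F" and N: "N \<in> M_1 X F"
    and eq: "\<And>a B. a \<in> A_c X \<Longrightarrow> B \<in> sets borel \<Longrightarrow>
      (\<integral>y. indicator B (u y) * a y \<partial>M) = (\<integral>y. indicator B (u y) * a y \<partial>N)"
    and a: "a \<in> A_c X"
  shows "(\<integral>y. u y * a y \<partial>M) = (\<integral>y. u y * a y \<partial>N)"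
proof -
  have uc: "continuous_on X u" using u by (rule A_c_continuous)
  note um = M_1_measurable[OF M uc] M_1_measurable[OF N uc]
  note space = M_1D(2)[OF M] M_1D(2)[OF N]
  obtain r where r: "\<And>x. x \<in> X \<Longrightarrow> \<bar>u x\<bar> \<le> r" using continuous_on_bound[OF X uc] by blast
  show ?thesis
  proof (rule A_c_integrals_eq_of_nonneg[OF X M N um r _ a])
    fix a assume a: "a \<in> A_c X" and nonneg: "\<And>x. x \<in> X \<Longrightarrow> 0 \<le> a x"
    note int = M_1_integrable[OF M X A_c_continuous[OF a]] M_1_integrable[OF N X A_c_continuous[OF a]]
    have "weighted_distr M a u = weighted_distr N a u"
      by (rule weighted_distr_eqI[OF int um]) (use nonneg space eq[OF a] in auto)
    then show "(\<integral>y. u y * a y \<partial>M) = (\<integral>y. u y * a y \<partial>N)"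
      using integral_weighted_distr[OF int(1) um(1), of "\<lambda>t. t"]
        integral_weighted_distr[OF int(2) um(2), of "\<lambda>t. t"] nonneg space by simp
  qed
qed

lemma indicator_vimage_integral:
  fixes a u :: "'a::topological_space \<Rightarrow> real"
  assumes "M \<in> M_1 X F"
  shows "(\<integral>y. indicator (u -` B \<inter> X) y * a y \<partial>M) = (\<integral>y. indicator B (u y) * a y \<partial>M)"
  using M_1D(2)[OF assms]
  by (intro Bochner_Integration.integral_cong) (auto split: split_indicator)

lemma vimage_sets_M_1:
  fixes u :: "'a::topological_space \<Rightarrow> real"
  assumes "M \<in> M_1 X F" "continuous_on X u" "B \<in> sets borel"
  shows "u -` B \<inter> X \<in> sets M"
  using measurable_sets[OF M_1_measurable[OF assms(1,2)] assms(3)] M_1D(2)[OF assms(1)] by simp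

lemma multiplier_imp_same_barycenter:
  fixes X :: "'a::locally_convex_space set"
  assumes X: "compact X" "convex X" and u: "multiplier X u"
    and M: "M \<in> M_1 X (closure (ext X))" and N: "N \<in> M_1 X (closure (ext X))"
    and B: "B \<in> sets borel" and same: "same_barycenter X M N"
  shows "measure M (u -` B \<inter> X) = measure N (u -` B \<inter> X)"
    and "measure M (u -` B \<inter> X) > 0 \<Longrightarrow>
      same_barycenter X (uniform_measure M (u -` B \<inter> X)) (uniform_measure N (u -` B \<inter> X))"
proof -
  define S where "S = u -` B \<inter> X"
  have uc: "continuous_on X u" using u by (simp add: multiplier_def A_c_continuous)
  have S: "S \<in> sets M" "S \<in> sets N"
    unfolding S_def by (rule vimage_sets_M_1[OF M uc B], rule vimage_sets_M_1[OF N uc B])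
  obtain x where x: "represents X M x" "represents X N x"
    using same by (auto simp: same_barycenter_def has_barycenter_iff_represents)
  have eq: "(\<integral>y. indicator S y * a y \<partial>M) = (\<integral>y. indicator S y * a y \<partial>N)" if a: "a \<in> A_c X" for a
    unfolding S_def indicator_vimage_integral[OF M] indicator_vimage_integral[OF N]
    by (rule multiplier_indicator_integrals[OF X(1) u M x(1) N x(2) a B])
  show m: "measure M (u -` B \<inter> X) = measure N (u -` B \<inter> X)"
    using eq[OF A_c_const[of 1]] S by (simp add: S_def[symmetric])
  assume "measure M (u -` B \<inter> X) > 0"
  then have pos: "measure M S > 0" "measure N S > 0" using m by (simp_all add: S_def)
  have fin: "finite_measure M" "finite_measure N"
    using M_1D(1)[OF M] M_1D(1)[OF N] by (simp_all add: prob_space_def)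
  have "(\<integral>y. a y \<partial>uniform_measure M S) = (\<integral>y. a y \<partial>uniform_measure N S)" if a: "a \<in> A_c X" for a
    using eq[OF a] m[folded S_def] A_c_continuous[OF a]
    by (simp add: integral_uniform_measure_eq fin S pos M_1_measurable[OF M] M_1_measurable[OF N])
  then have rep: "represents X (uniform_measure M S) y \<longleftrightarrow> represents X (uniform_measure N S) y" for y
    by (simp add: represents_def)
  \<comment> \<open>Equal integrals show only that the same points represent both measures; that
    there is such a point comes from the existence of barycenters.\<close>
  have "prob_space (uniform_measure M S)"
    using pos(1) finite_measure.emeasure_finite[OF fin(1)]
    by (intro prob_space_uniform_measure) (auto simp: measure_def)
  moreover have "space (uniform_measure M S) = X"
      "sets (uniform_measure M S) = sets (restrict_space borel X)"
    using M_1D[OF M] by simp_all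
  ultimately obtain y where "has_barycenter X (uniform_measure M S) y"
    using has_barycenter_exists[OF _ _ _ X] by blast
  then show "same_barycenter X (uniform_measure M (u -` B \<inter> X)) (uniform_measure N (u -` B \<inter> X))"
    using rep unfolding same_barycenter_def has_barycenter_iff_represents S_def by blast
qed

text \<open>The product \<open>u \<cdot> a\<close> on the extreme points is extended to \<open>X\<close> by its upper envelope. Both
  the upper and the lower envelope are integrals of \<open>u \<cdot> a\<close> against representing measures, so
  that they coincide; hence the extension is affine and continuous.\<close>

lemma multiplier_if_integrals_eq:
  fixes X :: "'a::locally_convex_space set"
  assumes X: "compact X" and cvx: "convex X" and u: "u \<in> A_c X"
    and eq: "\<And>M N x a. M \<in> M_1 X (closure (ext X)) \<Longrightarrow> N \<in> M_1 X (closure (ext X)) \<Longrightarrow>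
      represents X M x \<Longrightarrow> represents X N x \<Longrightarrow> a \<in> A_c X \<Longrightarrow>
      (\<integral>y. u y * a y \<partial>M) = (\<integral>y. u y * a y \<partial>N)"
  shows "multiplier X u"
  unfolding multiplier_def
proof (intro conjI ballI u)
  fix a assume a: "a \<in> A_c X"
  define g where "g = (\<lambda>x. u x * a x)"
  define g' where "g' = (\<lambda>x. - g x)"
  define b where "b = upper_envelope X g"
  have g: "continuous_on X g" and g': "continuous_on X g'"
    using A_c_continuous[OF u] A_c_continuous[OF a] unfolding g_def g'_def by (intro continuous_intros; simp)+
  \<comment> \<open>\<open>- upper_envelope X g'\<close> is the lower envelope of \<open>g\<close>,
    the supremum of the continuous affine functions below \<open>g\<close> on
    \<open>ext X\<close>.\<close>
  have lower: "upper_envelope X g' x = - b x" if x: "x \<in> X" for x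
  proof -
    obtain M where M: "M \<in> M_1 X (closure (ext X))" "represents X M x" "(\<integral>y. g y \<partial>M) = upper_envelope X g x"
      using upper_envelope_attained[OF X g x] by blast
    obtain N where N: "N \<in> M_1 X (closure (ext X))" "represents X N x" "(\<integral>y. g' y \<partial>N) = upper_envelope X g' x"
      using upper_envelope_attained[OF X g' x] by blast
    have "upper_envelope X g' x = - (\<integral>y. g y \<partial>N)" using N(3) by (simp add: g'_def)
    also have "(\<integral>y. g y \<partial>N) = (\<integral>y. g y \<partial>M)"
      unfolding g_def by (rule eq[OF N(1) M(1) N(2) M(2) a])
    finally show ?thesis using M(3) by (simp add: b_def)
  qed
  have "b \<in> A_c X"
    unfolding A_c_def
  proof (intro CollectI conjI ballI)
    show "continuous_on X b"
      unfolding continuous_on_def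
    proof (intro ballI order_tendstoI)
      fix x c assume x: "x \<in> X"
      show "eventually (\<lambda>y. b y < c) (at x within X)" if "b x < c"
        using upper_envelope_usc[OF X g x] that by (simp add: b_def)
      show "eventually (\<lambda>y. c < b y) (at x within X)" if "c < b x"
      proof -
        have "eventually (\<lambda>y. upper_envelope X g' y < - c) (at x within X)"
          using upper_envelope_usc[OF X g' x, of "- c"] lower[OF x] that by simp
        moreover have "eventually (\<lambda>y. y \<in> X) (at x within X)"
          by (simp add: eventually_at_topological) blast
        ultimately show ?thesis by eventually_elim (use lower in auto)
      qed
    qed
    fix x y t assume xy: "x \<in> X" "y \<in> X" and "t \<in> {0..1::real}"
    then have t: "0 \<le> t" "t \<le> 1" by auto
    show "b ((1 - t) *\<^sub>R x + t *\<^sub>R y) = (1 - t) * b x + t * b y"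
    proof -
      have "(1 - t) *\<^sub>R x + t *\<^sub>R y \<in> X" using cvx xy t by (intro convexD_alt)
      \<comment> \<open>Concavity of \<open>b\<close> and of \<open>- b\<close>.\<close>
      then show ?thesis
        using upper_envelope_concave[OF X g xy t] upper_envelope_concave[OF X g' xy t]
          lower xy by (simp add: b_def)
    qed
  qed
  moreover have "b x = u x * a x" if x: "x \<in> ext X" for x
  proof -
    \<comment> \<open>At an extreme point \<open>g\<close> lies between the lower and the upper
      envelope, which are both \<open>b\<close>.\<close>
    have "g x \<le> b x" unfolding b_def using x by (intro upper_envelope_ge[OF X g]) auto
    moreover have "g' x \<le> upper_envelope X g' x" using x by (intro upper_envelope_ge[OF X g']) auto
    moreover have "x \<in> X" using x ext_subset by blast
    ultimately show ?thesis using lower by (simp add: g_def g'_def)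
  qed
  ultimately show "\<exists>b\<in>A_c X. \<forall>x\<in>ext X. b x = u x * a x" by blast
qed

theorem proposition5p6:
  fixes X :: "'a::locally_convex_space set" and u :: "'a \<Rightarrow> real"
  assumes "compact X" and "convex X" and "u \<in> A_c X"
  shows "multiplier X u \<longleftrightarrow>
    (\<forall>\<mu>\<in>M_1 X (closure (ext X)). \<forall>\<nu>\<in>M_1 X (closure (ext X)). \<forall>B\<in>sets borel.
       same_barycenter X \<mu> \<nu> \<longrightarrow>
         measure \<mu> (u -` B \<inter> X) = measure \<nu> (u -` B \<inter> X) \<and>
         (measure \<mu> (u -` B \<inter> X) > 0 \<longrightarrow>
            same_barycenter X (uniform_measure \<mu> (u -` B \<inter> X))
                              (uniform_measure \<nu> (u -` B \<inter> X))))"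
  (is "_ \<longleftrightarrow> ?same")
proof
  show ?same if "multiplier X u"
    using multiplier_imp_same_barycenter[OF assms(1,2) that] by blast
next
  assume same: ?same
  note X = \<open>compact X\<close> and uc = A_c_continuous[OF \<open>u \<in> A_c X\<close>]
  show "multiplier X u"
  proof (rule multiplier_if_integrals_eq[OF assms])
    fix M N x a
    assume M: "M \<in> M_1 X (closure (ext X))" and N: "N \<in> M_1 X (closure (ext X))"
      and rep: "represents X M x" "represents X N x" and a: "a \<in> A_c X"
    have same_MN: "same_barycenter X M N"
      using rep by (auto simp: same_barycenter_def has_barycenter_iff_represents)
    show "(\<integral>y. u y * a y \<partial>M) = (\<integral>y. u y * a y \<partial>N)"
    proof (rule integral_mult_eq_of_indicator[OF X \<open>u \<in> A_c X\<close> M N _ a])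
      fix a and B :: "real set" assume a: "a \<in> A_c X" and B: "B \<in> sets borel"
      define S where "S = u -` B \<inter> X"
      have S: "S \<in> sets M" "S \<in> sets N"
        unfolding S_def by (rule vimage_sets_M_1[OF M uc B], rule vimage_sets_M_1[OF N uc B])
      have fin: "finite_measure M" "finite_measure N"
        using M_1D(1)[OF M] M_1D(1)[OF N] by (simp_all add: prob_space_def)
      have *: "measure M S = measure N S \<and> (measure M S > 0 \<longrightarrow>
          same_barycenter X (uniform_measure M S) (uniform_measure N S))"
        unfolding S_def using same M N B same_MN by blast
      have "(\<integral>y. indicator S y * a y \<partial>M) = (\<integral>y. indicator S y * a y \<partial>N)"
      \<comment> \<open>A positive common mass turns equality of barycenters into equality of
        integrals over \<open>S\<close>; with mass 0 both integrals vanish.\<close>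
      proof (cases "measure M S > 0")
        case True
        then have pos: "measure N S > 0" using * by simp
        obtain y where "represents X (uniform_measure M S) y" "represents X (uniform_measure N S) y"
          using * True by (auto simp: same_barycenter_def has_barycenter_iff_represents)
        then have "(\<integral>y. a y \<partial>uniform_measure M S) = (\<integral>y. a y \<partial>uniform_measure N S)"
          using a by (auto simp: represents_def)
        then show ?thesis
          using * True pos A_c_continuous[OF a]
          by (simp add: integral_uniform_measure_eq fin S M_1_measurable[OF M] M_1_measurable[OF N])
      next
        case False
        have zero: "(\<integral>y. indicator S y * a y \<partial>P) = 0"
          if P: "finite_measure P" "S \<in> sets P" "measure P S = 0" for P
        proof -
          have "S \<in> null_sets P"
            using P by (simp add: null_sets_def finite_measure.emeasure_eq_measure)
          then have "AE y in P. indicator S y * a y = 0"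
            by (rule AE_mp[OF AE_not_in]) (auto split: split_indicator)
          then show ?thesis by (rule integral_eq_zero_AE)
        qed
        have "measure M S = 0" using False measure_nonneg[of M S] by linarith
        then show ?thesis using * zero[OF fin(1) S(1)] zero[OF fin(2) S(2)] by simp
      qed
      then show "(\<integral>y. indicator B (u y) * a y \<partial>M) = (\<integral>y. indicator B (u y) * a y \<partial>N)"
        unfolding S_def indicator_vimage_integral[OF M] indicator_vimage_integral[OF N] .
    qed
  qed
qed

end
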